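(* Let $\Lambda$ be an arithmetic lattice, $\Gamma<\Lambda$ a torsion free, virtually unipotent subgroup, and $\eta \in \Lambda$ a nontrivial semisimple element. Then there exists a finite index subgroup $\Lambda_0$ of $\Lambda$ such that $\Gamma<\Lambda_0$ and $[\eta]_\Lambda \cap \Lambda_0 = \emptyset$.
   Context: $[\eta]_\Lambda$ denotes the $\Lambda$-conjugacy class of $\eta$. An arithmetic lattice is a subgroup $\Lambda<\mathbf{G}(\mathbf{Q})$, where $\mathbf{G}<\mathrm{GL}_n$ is a linear algebraic group defined over $\mathbf{Q}$, commensurable with $\mathbf{G}(\mathbf{Z})=\mathbf{G}\cap\mathrm{GL}(n,\mathbf{Z})$; thus $\Lambda<\mathrm{GL}(n,\mathbf{Q})$. An element is semisimple if it is diagonalizable over $\mathbf{C}$. A subgroup of $\mathrm{GL}(n,\mathbf{C})$ is unipotent if it is conjugate in $\mathrm{GL}(n,\mathbf{C})$ into the group of upper triangular matrices with ones on the diagonal, and virtually unipotent if it has a finite index unipotent subgroup. *)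

theory Defs
  imports
    "HOL-Algebra.Coset"
    "HOL-Library.Poly_Mapping"
    "Jordan_Normal_Form.Matrix"
begin

section \<open>Subgroups of an ambient group\<close>

definition finite_index_subgroup :: "('a, 'b) monoid_scheme \<Rightarrow> 'a set \<Rightarrow> 'a set \<Rightarrow> bool" where
  "finite_index_subgroup G H K \<longleftrightarrow>
     subgroup K (G\<lparr>carrier := H\<rparr>) \<and> finite (rcosets\<^bsub>G\<lparr>carrier := H\<rparr>\<^esub> K)"

definition commensurable :: "('a, 'b) monoid_scheme \<Rightarrow> 'a set \<Rightarrow> 'a set \<Rightarrow> bool" where
  "commensurable G H K \<longleftrightarrow>
     finite_index_subgroup G H (H \<inter> K) \<and> finite_index_subgroup G K (H \<inter> K)"

definition torsion_free :: "('a, 'b) monoid_scheme \<Rightarrow> 'a set \<Rightarrow> bool" where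
  "torsion_free G H \<longleftrightarrow> (\<forall>x\<in>H. \<forall>k::nat. k > 0 \<longrightarrow> x [^]\<^bsub>G\<^esub> k = \<one>\<^bsub>G\<^esub> \<longrightarrow> x = \<one>\<^bsub>G\<^esub>)"

definition conjugacy_class :: "('a, 'b) monoid_scheme \<Rightarrow> 'a set \<Rightarrow> 'a \<Rightarrow> 'a set" where
  "conjugacy_class G H x = {h \<otimes>\<^bsub>G\<^esub> x \<otimes>\<^bsub>G\<^esub> inv\<^bsub>G\<^esub> h | h. h \<in> H}"

section \<open>General linear groups\<close>

definition GL :: "nat \<Rightarrow> complex mat monoid" where
  "GL n = units_of (ring_mat TYPE(complex) n ())"

definition GL_Rats :: "nat \<Rightarrow> complex mat set" where
  "GL_Rats n = {A \<in> carrier (GL n). \<forall>i<n. \<forall>j<n. A $$ (i, j) \<in> \<rat>}"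

definition GL_Ints :: "nat \<Rightarrow> complex mat set" where
  "GL_Ints n = {A \<in> carrier (GL n).
     (\<forall>i<n. \<forall>j<n. A $$ (i, j) \<in> \<int>) \<and> (\<forall>i<n. \<forall>j<n. (inv\<^bsub>GL n\<^esub> A) $$ (i, j) \<in> \<int>)}"

section \<open>Linear algebraic groups over the rationals and arithmetic lattices\<close>

text \<open>
  A multivariate polynomial is a finitely supported map from monomials to coefficients, a
  monomial a finitely supported map from variables to exponents. The variable \<open>(i, j)\<close> stands for
  the matrix entry in row \<open>i\<close> and column \<open>j\<close>, counted from \<open>0\<close>.
\<close>

type_synonym rat_mpoly = "((nat \<times> nat) \<Rightarrow>\<^sub>0 nat) \<Rightarrow>\<^sub>0 rat"

definition entry_polys :: "nat \<Rightarrow> rat_mpoly set" where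
  "entry_polys n = {p. \<forall>m \<in> Poly_Mapping.keys p. Poly_Mapping.keys m \<subseteq> {..<n} \<times> {..<n}}"

definition eval_at :: "rat_mpoly \<Rightarrow> complex mat \<Rightarrow> complex" where
  "eval_at p A = (\<Sum>m \<in> Poly_Mapping.keys p. of_rat (Poly_Mapping.lookup p m) *
     (\<Prod>x \<in> Poly_Mapping.keys m. A $$ x ^ Poly_Mapping.lookup m x))"

text \<open>
  An algebraic group is identified with its group of complex points. It is defined over the
  rationals if it is cut out in \<open>GL n\<close> by polynomials with rational coefficients; as the rationals
  are a perfect field, this agrees with requiring the vanishing ideal to be generated by such
  polynomials.
\<close>

definition algebraic_group_over_Rats :: "nat \<Rightarrow> complex mat set \<Rightarrow> bool" where
  "algebraic_group_over_Rats n G \<longleftrightarrow>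
     subgroup G (GL n) \<and>
     (\<exists>P \<subseteq> entry_polys n. G = {A \<in> carrier (GL n). \<forall>p\<in>P. eval_at p A = 0})"

definition arithmetic_lattice :: "nat \<Rightarrow> complex mat set \<Rightarrow> bool" where
  "arithmetic_lattice n \<Lambda> \<longleftrightarrow>
     (\<exists>G. algebraic_group_over_Rats n G \<and> subgroup \<Lambda> (GL n) \<and> \<Lambda> \<subseteq> G \<inter> GL_Rats n \<and>
          commensurable (GL n) \<Lambda> (G \<inter> GL_Ints n))"

section \<open>Semisimple elements and unipotent subgroups\<close>

definition semisimple_mat :: "complex mat \<Rightarrow> bool" where
  "semisimple_mat A \<longleftrightarrow> (\<exists>D. diagonal_mat D \<and> similar_mat A D)"

definition upper_unitriangular :: "nat \<Rightarrow> complex mat set" where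
  "upper_unitriangular n =
     {A \<in> carrier (GL n). upper_triangular A \<and> (\<forall>i<n. A $$ (i, i) = 1)}"

definition unipotent_subgroup :: "nat \<Rightarrow> complex mat set \<Rightarrow> bool" where
  "unipotent_subgroup n U \<longleftrightarrow>
     subgroup U (GL n) \<and>
     (\<exists>P \<in> carrier (GL n). \<forall>A\<in>U. P \<otimes>\<^bsub>GL n\<^esub> A \<otimes>\<^bsub>GL n\<^esub> inv\<^bsub>GL n\<^esub> P \<in> upper_unitriangular n)"

definition virtually_unipotent :: "nat \<Rightarrow> complex mat set \<Rightarrow> bool" where
  "virtually_unipotent n H \<longleftrightarrow>
     (\<exists>U. finite_index_subgroup (GL n) H U \<and> unipotent_subgroup n U)"

end

theory Submission
  imports Defs "HOL-Computational_Algebra.Polynomial"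
begin

text \<open>
  The subgroup sought is \<open>\<Gamma> N\<close> for a deep enough normal finite index subgroup \<open>N\<close> of \<open>\<Lambda>\<close>. Let \<open>U\<close> be a
  normal finite index subgroup of \<open>\<Gamma>\<close> that is unipotent and integral, and \<open>m > 0\<close> with \<open>g ^ m \<in> U\<close>
  for all \<open>g \<in> \<Gamma>\<close>. A semisimple \<open>\<theta> \<noteq> 1\<close> has a power whose trace is not \<open>n\<close>, while all elements
  of \<open>U\<close> have trace \<open>n\<close>; comparing traces modulo a large integer, no conjugate of \<open>\<theta>\<close> lies in
  \<open>U N\<close>. This settles the case \<open>\<eta> ^ m \<noteq> 1\<close> with \<open>\<theta> = \<eta> ^ m\<close>.

  If \<open>\<eta> ^ m = 1\<close> and a conjugate of \<open>\<eta>\<close> lies in \<open>g N\<close> with \<open>g \<in> \<Gamma>\<close>, then \<open>g ^ m \<in> U \<inter> N\<close> is close to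
  \<open>1\<close>. Descending along a \<open>\<Gamma>\<close>-invariant central filtration of \<open>U\<close> with torsion-free quotients, in which
  elements close to \<open>1\<close> are highly divisible, one corrects \<open>g\<close> by some \<open>u \<in> U\<close> to \<open>(g u) ^ m = 1\<close>.
  As \<open>\<Gamma>\<close> is torsion free, \<open>g \<in> U\<close>, and the trace argument applies with \<open>\<theta> = \<eta>\<close>.
\<close>

section \<open>Subgroups of finite index\<close>

lemma (in group) r_coset_eq_iff:
  assumes "subgroup K G" "x \<in> carrier G" "y \<in> carrier G"
  shows "K #> x = K #> y \<longleftrightarrow> x \<otimes> inv y \<in> K"
proof
  assume "K #> x = K #> y"
  then have "x \<in> K #> y" using rcos_self[OF assms(2,1)] by simp
  then show "x \<otimes> inv y \<in> K"
    using subgroup.rcos_module_imp[OF assms(1) is_group assms(3)] by simp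
next
  assume "x \<otimes> inv y \<in> K"
  then have "x \<in> K #> y"
    using subgroup.rcos_module_rev[OF assms(1) is_group assms(3,2)] by simp
  then show "K #> x = K #> y" using repr_independence[OF _ assms(3,1)] by simp
qed

lemma (in group) inv_cancel_left:
  assumes "x \<in> carrier G" "y \<in> carrier G"
  shows "inv x \<otimes> (x \<otimes> y) = y"
  using assms by (simp add: m_assoc[symmetric])

lemma (in group) conj_nat_pow:
  assumes "g \<in> carrier G" "x \<in> carrier G"
  shows "(g \<otimes> x \<otimes> inv g) [^] (k::nat) = g \<otimes> x [^] k \<otimes> inv g"
  using assms by (induction k) (simp_all add: m_assoc inv_cancel_left)

text \<open>The coset of \<open>x\<close> depends only on \<open>f x\<close>, so there are at most
  as many cosets as values of \<open>f\<close>. Finite index is proved below by exhibiting such an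
  \<open>f\<close>.\<close>

lemma (in group) finite_index_subgroupI:
  assumes H: "subgroup H G" and K: "subgroup K G" and KH: "K \<subseteq> H" and fin: "finite (f ` H)"
    and f: "\<And>x y. x \<in> H \<Longrightarrow> y \<in> H \<Longrightarrow> f x = f y \<Longrightarrow> x \<otimes> inv y \<in> K"
  shows "finite_index_subgroup G H K"
proof -
  \<comment> \<open>\<open>g\<close> turns a value of \<open>f\<close> back into a coset, through a
    chosen preimage in \<open>H\<close>.\<close>
  define g where "g c = K #> (SOME y. y \<in> H \<and> f y = c)" for c
  have g: "K #> x = g (f x)" if x: "x \<in> H" for x
  proof -
    define y where "y = (SOME y. y \<in> H \<and> f y = f x)"
    have "y \<in> H \<and> f y = f x"
      unfolding y_def by (rule someI[of _ x]) (use x in auto)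
    then have "K #> x = K #> y"
      using r_coset_eq_iff[OF K, of x y] f[of x y] x subgroup.subset[OF H] by auto
    then show ?thesis unfolding g_def y_def .
  qed
  have "rcosets\<^bsub>G\<lparr>carrier := H\<rparr>\<^esub> K \<subseteq> g ` f ` H"
    unfolding RCOSETS_def by (auto simp: g)
  then have "finite (rcosets\<^bsub>G\<lparr>carrier := H\<rparr>\<^esub> K)"
    using fin finite_subset by blast
  then show ?thesis
    unfolding finite_index_subgroup_def using subgroup_incl[OF K H KH] by simp
qed

lemma (in group) finite_index_subgroupD:
  assumes "subgroup H G" "finite_index_subgroup G H K"
  shows "subgroup K G" "K \<subseteq> H" "finite ((\<lambda>x. K #> x) ` H)"
proof -
  have K: "subgroup K (G\<lparr>carrier := H\<rparr>)" and fin: "finite (rcosets\<^bsub>G\<lparr>carrier := H\<rparr>\<^esub> K)"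
    using assms(2) by (auto simp: finite_index_subgroup_def)
  show "subgroup K G" using incl_subgroup[OF assms(1) K] .
  show "K \<subseteq> H" using subgroup.subset[OF K] by simp
  have "(\<lambda>x. K #> x) ` H = rcosets\<^bsub>G\<lparr>carrier := H\<rparr>\<^esub> K" unfolding RCOSETS_def by auto
  then show "finite ((\<lambda>x. K #> x) ` H)" using fin by simp
qed

lemma (in group) finite_index_subgroup_mono:
  assumes "subgroup H G" "finite_index_subgroup G H K" "subgroup L G" "K \<subseteq> L" "L \<subseteq> H"
  shows "finite_index_subgroup G H L"
proof (rule finite_index_subgroupI[OF assms(1,3,5), where f = "\<lambda>x. K #> x"])
  note K = finite_index_subgroupD[OF assms(1,2)]
  show "finite ((\<lambda>x. K #> x) ` H)" by (rule K(3))
  fix x y assume "x \<in> H" "y \<in> H" "K #> x = K #> y"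
  then show "x \<otimes> inv y \<in> L"
    using r_coset_eq_iff[OF K(1), of x y] subgroup.subset[OF assms(1)] assms(4) by auto
qed

lemma (in group) finite_index_subgroup_Int:
  assumes H: "subgroup H G" and "finite_index_subgroup G H K" "finite_index_subgroup G H L"
  shows "finite_index_subgroup G H (K \<inter> L)"
proof -
  note K = finite_index_subgroupD[OF assms(1,2)] and L = finite_index_subgroupD[OF assms(1,3)]
  show ?thesis
  proof (rule finite_index_subgroupI[OF H, where f = "\<lambda>x. (K #> x, L #> x)"])
    show "subgroup (K \<inter> L) G" using K(1) L(1) by (rule subgroups_Inter_pair)
    show "K \<inter> L \<subseteq> H" using K(2) by blast
    have "(\<lambda>x. (K #> x, L #> x)) ` H \<subseteq> ((\<lambda>x. K #> x) ` H) \<times> ((\<lambda>x. L #> x) ` H)" by auto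
    then show "finite ((\<lambda>x. (K #> x, L #> x)) ` H)"
      using K(3) L(3) by (meson finite_SigmaI finite_subset)
    fix x y assume "x \<in> H" "y \<in> H" "(K #> x, L #> x) = (K #> y, L #> y)"
    then show "x \<otimes> inv y \<in> K \<inter> L"
      using r_coset_eq_iff[OF K(1), of x y] r_coset_eq_iff[OF L(1), of x y] subgroup.subset[OF H]
      by auto
  qed
qed

lemma (in group) finite_index_subgroup_restrict:
  assumes H: "subgroup H G" and "finite_index_subgroup G H K" and L: "subgroup L G" "L \<subseteq> H"
  shows "finite_index_subgroup G L (L \<inter> K)"
proof -
  note K = finite_index_subgroupD[OF assms(1,2)]
  show ?thesis
  proof (rule finite_index_subgroupI[OF L(1), where f = "\<lambda>x. K #> x"])
    show "subgroup (L \<inter> K) G" using L(1) K(1) by (rule subgroups_Inter_pair)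
    show "finite ((\<lambda>x. K #> x) ` L)"
      using K(3) L(2) by (meson finite_subset image_mono)
    fix x y assume "x \<in> L" "y \<in> L" "K #> x = K #> y"
    then show "x \<otimes> inv y \<in> L \<inter> K"
      using r_coset_eq_iff[OF K(1), of x y] subgroup.subset[OF L(1)]
        subgroup.m_closed[OF L(1)] subgroup.m_inv_closed[OF L(1)] by auto
  qed simp
qed

lemma (in group) finite_index_subgroup_trans:
  assumes H: "subgroup H G" and "finite_index_subgroup G H K" "finite_index_subgroup G K L"
  shows "finite_index_subgroup G H L"
proof -
  note K = finite_index_subgroupD[OF assms(1,2)]
  note L = finite_index_subgroupD[OF K(1) assms(3)]
  \<comment> \<open>\<open>r\<close> picks a representative in \<open>H\<close> of each coset of
    \<open>K\<close>. The coset \<open>K x\<close> and the \<open>L\<close>-coset of the remaining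
    factor in \<open>K\<close> together determine \<open>L x\<close>, since the common
    representative cancels.\<close>
  define r where "r C = (SOME y. y \<in> H \<and> K #> y = C)" for C
  have r: "r (K #> x) \<in> H" "x \<otimes> inv (r (K #> x)) \<in> K" if x: "x \<in> H" for x
  proof -
    have "r (K #> x) \<in> H \<and> K #> r (K #> x) = K #> x"
      unfolding r_def by (rule someI[of _ x]) (use x in auto)
    then show "r (K #> x) \<in> H" "x \<otimes> inv (r (K #> x)) \<in> K"
      using r_coset_eq_iff[OF K(1), of x "r (K #> x)"] x subgroup.subset[OF H] by auto
  qed
  show ?thesis
  proof (rule finite_index_subgroupI[OF H L(1),
        where f = "\<lambda>x. (K #> x, L #> (x \<otimes> inv (r (K #> x))))"])
    show "L \<subseteq> H" using L(2) K(2) by blast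
    have "(\<lambda>x. (K #> x, L #> (x \<otimes> inv (r (K #> x))))) ` H
      \<subseteq> ((\<lambda>x. K #> x) ` H) \<times> ((\<lambda>x. L #> x) ` K)"
      using r by auto
    then show "finite ((\<lambda>x. (K #> x, L #> (x \<otimes> inv (r (K #> x))))) ` H)"
      using K(3) L(3) by (meson finite_SigmaI finite_subset)
    fix x y assume xy: "x \<in> H" "y \<in> H"
      and eq: "(K #> x, L #> (x \<otimes> inv (r (K #> x)))) = (K #> y, L #> (y \<otimes> inv (r (K #> y))))"
    define z where "z = r (K #> x)"
    have z: "z \<in> carrier G" "x \<in> carrier G" "y \<in> carrier G"
      using r(1)[OF xy(1)] xy subgroup.subset[OF H] by (auto simp: z_def)
    have "L #> (x \<otimes> inv z) = L #> (y \<otimes> inv z)" using eq by (auto simp: z_def)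
    then have "(x \<otimes> inv z) \<otimes> inv (y \<otimes> inv z) \<in> L"
      using r_coset_eq_iff[OF L(1)] z by simp
    moreover have "(x \<otimes> inv z) \<otimes> inv (y \<otimes> inv z) = x \<otimes> inv y"
      using z by (simp add: inv_mult_group m_assoc) (simp add: m_assoc[symmetric])
    ultimately show "x \<otimes> inv y \<in> L" by simp
  qed
qed

section \<open>Normal subgroups of finite index, cores and exponents\<close>

definition normal_finite_index :: "('a, 'b) monoid_scheme \<Rightarrow> 'a set \<Rightarrow> 'a set \<Rightarrow> bool" where
  "normal_finite_index G H N \<longleftrightarrow>
     finite_index_subgroup G H N \<and> (\<forall>h\<in>H. \<forall>x\<in>N. h \<otimes>\<^bsub>G\<^esub> x \<otimes>\<^bsub>G\<^esub> inv\<^bsub>G\<^esub> h \<in> N)"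

lemma (in group) normal_finite_indexD:
  assumes "subgroup H G" "normal_finite_index G H N"
  shows "finite_index_subgroup G H N" "subgroup N G" "N \<subseteq> H"
    "\<And>h x. h \<in> H \<Longrightarrow> x \<in> N \<Longrightarrow> h \<otimes> x \<otimes> inv h \<in> N"
proof -
  show fi: "finite_index_subgroup G H N"
    using assms(2) by (simp add: normal_finite_index_def)
  show "subgroup N G" "N \<subseteq> H"
    using finite_index_subgroupD[OF assms(1) fi] by simp_all
  show "h \<otimes> x \<otimes> inv h \<in> N" if "h \<in> H" "x \<in> N" for h x
    using assms(2) that by (simp add: normal_finite_index_def)
qed

lemma (in group) normal_finite_index_Int:
  assumes "subgroup H G" "normal_finite_index G H K" "normal_finite_index G H L"
  shows "normal_finite_index G H (K \<inter> L)"
  using assms finite_index_subgroup_Int unfolding normal_finite_index_def by simp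

lemma (in group) normal_finite_index_self:
  assumes "subgroup H G"
  shows "normal_finite_index G H H"
  unfolding normal_finite_index_def
  using finite_index_subgroupI[OF assms assms, where f = "\<lambda>_. ()"] assms
  by (auto intro!: subgroup.m_closed subgroup.m_inv_closed)

text \<open>The core of \<open>K\<close> is the kernel of the action of \<open>H\<close> on the
  finite set of right cosets of \<open>K\<close>, hence it has finite index.\<close>

lemma (in group) normal_core:
  assumes H: "subgroup H G" and "finite_index_subgroup G H K"
  obtains N where "normal_finite_index G H N" "N \<subseteq> K"
proof -
  note K = finite_index_subgroupD[OF assms]
  note sH = subgroup.subset[OF H] and sK = subgroup.subset[OF K(1)]
  \<comment> \<open>The intersection of the conjugates \<open>r^-1 K r\<close> with \<open>r\<close>
    in \<open>H\<close>.\<close>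
  define N where "N = {g \<in> H. \<forall>r\<in>H. r \<otimes> g \<otimes> inv r \<in> K}"
  have NK: "N \<subseteq> K"
  proof
    fix g assume "g \<in> N"
    then have "\<one> \<otimes> g \<otimes> inv \<one> \<in> K" "g \<in> carrier G"
      using subgroup.one_closed[OF H] sH unfolding N_def by blast+
    then show "g \<in> K" by simp
  qed
  have Nsub: "subgroup N G"
  proof (rule subgroupI)
    show "N \<subseteq> carrier G" using sH by (auto simp: N_def)
    have "\<one> \<in> N"
      using sH subgroup.one_closed[OF H] subgroup.one_closed[OF K(1)] by (auto simp: N_def)
    then show "N \<noteq> {}" by blast
    fix a assume a: "a \<in> N"
    have "r \<otimes> inv a \<otimes> inv r \<in> K" if "r \<in> H" for r
    proof -
      have "inv (r \<otimes> a \<otimes> inv r) \<in> K"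
        using a that K(1) by (auto simp: N_def intro: subgroup.m_inv_closed)
      moreover have "inv (r \<otimes> a \<otimes> inv r) = r \<otimes> inv a \<otimes> inv r"
        using a that sH by (auto simp: N_def inv_mult_group m_assoc subset_iff)
      ultimately show ?thesis by simp
    qed
    then show "inv a \<in> N"
      using a H by (auto simp: N_def intro: subgroup.m_inv_closed)
    fix b assume b: "b \<in> N"
    have "r \<otimes> (a \<otimes> b) \<otimes> inv r \<in> K" if "r \<in> H" for r
    proof -
      have c: "r \<in> carrier G" "a \<in> carrier G" "b \<in> carrier G"
        using a b that sH by (auto simp: N_def)
      have "(r \<otimes> a \<otimes> inv r) \<otimes> (r \<otimes> b \<otimes> inv r) \<in> K"
        using a b that K(1) by (auto simp: N_def intro: subgroup.m_closed)
      moreover have "(r \<otimes> a \<otimes> inv r) \<otimes> (r \<otimes> b \<otimes> inv r) = r \<otimes> (a \<otimes> b) \<otimes> inv r"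
        using c by (simp add: m_assoc inv_cancel_left)
      ultimately show ?thesis by simp
    qed
    then show "a \<otimes> b \<in> N"
      using a b H by (auto simp: N_def intro: subgroup.m_closed)
  qed
  define RC where "RC = (\<lambda>x. K #> x) ` H"
  \<comment> \<open>Right multiplication by \<open>g\<close> on the cosets; \<open>restrict\<close>
    makes it a member of the finite set of extensional self-maps of \<open>RC\<close>.\<close>
  define f where "f g = restrict (\<lambda>C. C #> g) RC" for g
  have "finite_index_subgroup G H N"
  proof (rule finite_index_subgroupI[OF H Nsub, where f = f])
    show "N \<subseteq> H" by (auto simp: N_def)
    have "(K #> r) #> g \<in> RC" if "r \<in> H" "g \<in> H" for r g
    proof -
      have "(K #> r) #> g = K #> (r \<otimes> g)" using that sH sK by (intro coset_mult_assoc) auto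
      then show ?thesis using that H by (auto simp: RC_def intro: subgroup.m_closed)
    qed
    then have "f ` H \<subseteq> RC \<rightarrow>\<^sub>E RC"
      by (auto simp: f_def RC_def PiE_iff)
    moreover have "finite (RC \<rightarrow>\<^sub>E RC)" using K(3) by (intro finite_PiE) (auto simp: RC_def)
    ultimately show "finite (f ` H)" by (rule finite_subset)
    fix x y assume xy: "x \<in> H" "y \<in> H" and eq: "f x = f y"
    have "r \<otimes> (x \<otimes> inv y) \<otimes> inv r \<in> K" if r: "r \<in> H" for r
    proof -
      have c: "r \<in> carrier G" "x \<in> carrier G" "y \<in> carrier G" using r xy sH by auto
      have "(K #> r) #> x = (K #> r) #> y"
        using fun_cong[OF eq, of "K #> r"] r by (simp add: f_def RC_def)
      then have "K #> (r \<otimes> x) = K #> (r \<otimes> y)" using c sK by (simp add: coset_mult_assoc)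
      then have "(r \<otimes> x) \<otimes> inv (r \<otimes> y) \<in> K" using r_coset_eq_iff[OF K(1)] c by simp
      then show ?thesis using c by (simp add: inv_mult_group m_assoc)
    qed
    then show "x \<otimes> inv y \<in> N"
      using xy H by (auto simp: N_def intro: subgroup.m_closed subgroup.m_inv_closed)
  qed
  moreover have "h \<otimes> x \<otimes> inv h \<in> N" if h: "h \<in> H" and x: "x \<in> N" for h x
  proof -
    have "r \<otimes> (h \<otimes> x \<otimes> inv h) \<otimes> inv r \<in> K" if r: "r \<in> H" for r
    proof -
      have "(r \<otimes> h) \<otimes> x \<otimes> inv (r \<otimes> h) \<in> K"
        using x r h H by (auto simp: N_def intro: subgroup.m_closed)
      moreover have "r \<in> carrier G" "h \<in> carrier G" "x \<in> carrier G"
        using r h x sH by (auto simp: N_def)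
      ultimately show ?thesis by (simp add: m_assoc inv_mult_group)
    qed
    then show ?thesis
      using h x H by (auto simp: N_def intro: subgroup.m_closed subgroup.m_inv_closed)
  qed
  ultimately have "normal_finite_index G H N" unfolding normal_finite_index_def by blast
  then show thesis using that NK by blast
qed

text \<open>Pigeonhole: among the powers of \<open>x\<close> with exponents from 0 to the number
  \<open>c\<close> of cosets, two share a coset, so some exponent between 1 and \<open>c\<close>
  takes \<open>x\<close> into \<open>K\<close>. That exponent varies with \<open>x\<close>, but it
  always divides \<open>fact c\<close>.\<close>

lemma (in group) finite_index_exponent:
  assumes H: "subgroup H G" and "finite_index_subgroup G H K"
  obtains e :: nat where "e > 0" "\<And>x. x \<in> H \<Longrightarrow> x [^] e \<in> K"
proof -
  note K = finite_index_subgroupD[OF assms]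
  define RC where "RC = (\<lambda>x. K #> x) ` H"
  have fin: "finite RC" using K(3) by (simp add: RC_def)
  have "x [^] (fact (card RC) :: nat) \<in> K" if x: "x \<in> H" for x
  proof -
    have xc: "x \<in> carrier G" using x subgroup.subset[OF H] by blast
    have xp: "x [^] i \<in> H" for i :: nat
      by (induction i) (use x H in \<open>auto intro: subgroup.m_closed subgroup.one_closed\<close>)
    have "\<not> inj_on (\<lambda>i. K #> (x [^] i)) {..card RC}"
    proof
      assume "inj_on (\<lambda>i. K #> (x [^] i)) {..card RC}"
      then have "card {..card RC} \<le> card RC"
        using fin xp by (intro card_inj_on_le[of "\<lambda>i. K #> (x [^] i)"]) (auto simp: RC_def)
      then show False by simp
    qed
    then obtain a b :: nat where ab: "a < b" "b \<le> card RC" "K #> (x [^] a) = K #> (x [^] b)"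
      unfolding inj_on_def by (metis atMost_iff linorder_neqE_nat)
    have "x [^] b \<otimes> inv (x [^] a) \<in> K"
      using r_coset_eq_iff[OF K(1), of "x [^] b" "x [^] a"] ab(3) xc by simp
    moreover have "x [^] b = x [^] (b - a) \<otimes> x [^] a"
      using xc ab(1) by (simp add: nat_pow_mult)
    ultimately have p: "x [^] (b - a) \<in> K" using xc by (simp add: m_assoc)
    have "(b - a) dvd fact (card RC)" using ab by (intro dvd_fact) auto
    then obtain k where "fact (card RC) = (b - a) * k" by blast
    then have "x [^] (fact (card RC) :: nat) = (x [^] (b - a)) [^] k"
      using xc by (simp add: nat_pow_pow)
    also have "\<dots> \<in> K"
      by (induction k) (use p K(1) in \<open>auto intro: subgroup.m_closed subgroup.one_closed\<close>)
    finally show ?thesis .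
  qed
  then show thesis using that[of "fact (card RC)"] by simp
qed

section \<open>Correcting an element whose power is trivial modulo normal subgroups\<close>

lemma (in group) normal_obtains_hom:
  assumes "N \<lhd> G"
  obtains F :: "'a set monoid" and h where
    "group_hom G F h" "\<And>x. x \<in> carrier G \<Longrightarrow> h x = \<one>\<^bsub>F\<^esub> \<longleftrightarrow> x \<in> N"
proof -
  interpret N: normal N G by (rule assms)
  interpret h: group_hom G "G Mod N" "(#>) N"
    by (intro group_hom.intro is_group N.factorgroup_is_group group_hom_axioms.intro N.r_coset_hom_Mod)
  have "N #> x = \<one>\<^bsub>G Mod N\<^esub> \<longleftrightarrow> x \<in> N" if "x \<in> carrier G" for x
    using r_coset_eq_iff[OF N.subgroup_axioms that one_closed] that h.hom_one N.subset
    by (simp add: coset_mult_one)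
  then show thesis using that h.group_hom_axioms by blast
qed

text \<open>
  Modulo \<open>W\<close> the element \<open>b [^] (m * e)\<close> is \<open>g [^] m\<close> and so is fixed by \<open>g\<close>; roots in \<open>V / W\<close> being
  unique, \<open>b\<close> commutes with \<open>g\<close> modulo \<open>W\<close>.
\<close>

lemma (in group) correct_torsion_step:
  assumes V: "V \<lhd> G" and W: "W \<lhd> G" and N: "N \<lhd> G"
    and e: "\<And>x. x \<in> V \<Longrightarrow> x [^] e \<in> N"
    and tf: "\<And>x y. x \<in> V \<Longrightarrow> y \<in> V \<Longrightarrow> x [^] (m * e) \<otimes> inv (y [^] (m * e)) \<in> W
      \<Longrightarrow> x \<otimes> inv y \<in> W"
    and g: "g \<in> carrier G" "g [^] m \<in> N"
    and b: "b \<in> V" "inv (b [^] (m * e)) \<otimes> g [^] m \<in> W"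
  shows "(g \<otimes> inv (b [^] e)) [^] (m :: nat) \<in> W \<inter> N"
proof -
  \<comment> \<open>Congruences modulo \<open>W\<close> become equations in \<open>F\<close>, and
    congruences modulo \<open>N\<close> equations in \<open>F'\<close>.\<close>
  obtain F :: "'a set monoid" and h where hF: "group_hom G F h"
    and W1: "\<And>x. x \<in> carrier G \<Longrightarrow> h x = \<one>\<^bsub>F\<^esub> \<longleftrightarrow> x \<in> W"
    using normal_obtains_hom[OF W] by blast
  obtain F' :: "'a set monoid" and k where kF: "group_hom G F' k"
    and N1: "\<And>x. x \<in> carrier G \<Longrightarrow> k x = \<one>\<^bsub>F'\<^esub> \<longleftrightarrow> x \<in> N"
    using normal_obtains_hom[OF N] by blast
  interpret V: normal V G by (rule V)
  interpret h: group_hom G F h by (rule hF)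
  interpret k: group_hom G F' k by (rule kF)
  have bc: "b \<in> carrier G" using b(1) V.subset by blast
  define B where "B = h b"
  define C where "C = h g"
  have BC: "B \<in> carrier F" "C \<in> carrier F"
    using bc g by (auto simp: B_def C_def)
  have "h (inv (b [^] (m * e)) \<otimes> g [^] m) = \<one>\<^bsub>F\<^esub>"
    using W1[of "inv (b [^] (m * e)) \<otimes> g [^] m"] b(2) g(1) bc by simp
  then have "inv\<^bsub>F\<^esub> (B [^]\<^bsub>F\<^esub> (m * e)) \<otimes>\<^bsub>F\<^esub> C [^]\<^bsub>F\<^esub> m = \<one>\<^bsub>F\<^esub>"
    using bc g by (simp add: B_def C_def h.hom_nat_pow)
  then have CB: "C [^]\<^bsub>F\<^esub> m = B [^]\<^bsub>F\<^esub> (m * e)"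
    using BC h.H.inv_equality[of "inv\<^bsub>F\<^esub> (B [^]\<^bsub>F\<^esub> (m * e))" "C [^]\<^bsub>F\<^esub> m"]
    by (metis h.H.inv_inv h.H.nat_pow_closed h.H.inv_closed)
  \<comment> \<open>Conjugating \<open>b\<close> by \<open>g\<close> does not change its power with
    exponent \<open>m * e\<close> modulo \<open>W\<close>, because that power is \<open>C^m\<close>,
    which commutes with \<open>C\<close>.\<close>
  define b' where "b' = g \<otimes> b \<otimes> inv g"
  have b': "b' \<in> V" "b' \<in> carrier G"
    using V.inv_op_closed2[OF g(1) b(1)] V.subset by (auto simp: b'_def)
  have conj_pow: "b' [^] j = g \<otimes> b [^] j \<otimes> inv g" for j :: nat
    unfolding b'_def by (rule conj_nat_pow[OF g(1) bc])
  have "h (b' [^] (m * e)) = C \<otimes>\<^bsub>F\<^esub> C [^]\<^bsub>F\<^esub> m \<otimes>\<^bsub>F\<^esub> inv\<^bsub>F\<^esub> C"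
    unfolding conj_pow using bc g by (simp add: B_def C_def h.hom_nat_pow CB[unfolded C_def B_def])
  also have "C \<otimes>\<^bsub>F\<^esub> C [^]\<^bsub>F\<^esub> m = C [^]\<^bsub>F\<^esub> m \<otimes>\<^bsub>F\<^esub> C"
    using h.H.nat_pow_Suc2[OF BC(2), of m] by simp
  also have "C [^]\<^bsub>F\<^esub> m \<otimes>\<^bsub>F\<^esub> C \<otimes>\<^bsub>F\<^esub> inv\<^bsub>F\<^esub> C = C [^]\<^bsub>F\<^esub> m"
    using BC by (simp add: h.H.m_assoc)
  also have "\<dots> = h (b [^] (m * e))"
    using bc by (simp add: CB B_def h.hom_nat_pow)
  finally have "h (b' [^] (m * e) \<otimes> inv (b [^] (m * e))) = \<one>\<^bsub>F\<^esub>"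
    using bc b' by simp
  then have "b' [^] (m * e) \<otimes> inv (b [^] (m * e)) \<in> W"
    using W1[of "b' [^] (m * e) \<otimes> inv (b [^] (m * e))"] bc b' by simp
  then have "b' \<otimes> inv b \<in> W" using tf b' b by blast
  then have "h (b' \<otimes> inv b) = \<one>\<^bsub>F\<^esub>"
    using W1[of "b' \<otimes> inv b"] b'(2) bc by simp
  then have "C \<otimes>\<^bsub>F\<^esub> B \<otimes>\<^bsub>F\<^esub> inv\<^bsub>F\<^esub> (B \<otimes>\<^bsub>F\<^esub> C) = \<one>\<^bsub>F\<^esub>"
    using bc g by (simp add: B_def C_def b'_def h.H.m_assoc h.H.inv_mult_group)
  then have "C \<otimes>\<^bsub>F\<^esub> B = inv\<^bsub>F\<^esub> (inv\<^bsub>F\<^esub> (B \<otimes>\<^bsub>F\<^esub> C))"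
    using BC by (intro h.H.inv_equality[symmetric]) simp_all
  then have comm: "C \<otimes>\<^bsub>F\<^esub> B = B \<otimes>\<^bsub>F\<^esub> C"
    using BC by simp
  \<comment> \<open>As \<open>C\<close> commutes with \<open>D\<close>, the \<open>m\<close>-th
    power of \<open>C D^-1\<close> splits into \<open>C^m\<close> times the inverse of
    \<open>B^(m e)\<close>, which is trivial.\<close>
  define D where "D = B [^]\<^bsub>F\<^esub> e"
  have D: "D \<in> carrier F" using BC by (simp add: D_def)
  have CD: "D \<otimes>\<^bsub>F\<^esub> C = C \<otimes>\<^bsub>F\<^esub> D"
    unfolding D_def using h.H.group_commutes_pow[OF comm[symmetric] BC] .
  have "inv\<^bsub>F\<^esub> D \<otimes>\<^bsub>F\<^esub> (D \<otimes>\<^bsub>F\<^esub> C) \<otimes>\<^bsub>F\<^esub> inv\<^bsub>F\<^esub> D = inv\<^bsub>F\<^esub> D \<otimes>\<^bsub>F\<^esub> (C \<otimes>\<^bsub>F\<^esub> D) \<otimes>\<^bsub>F\<^esub> inv\<^bsub>F\<^esub> D"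
    by (simp only: CD)
  then have "C \<otimes>\<^bsub>F\<^esub> inv\<^bsub>F\<^esub> D = inv\<^bsub>F\<^esub> D \<otimes>\<^bsub>F\<^esub> C"
    using BC D by (simp add: h.H.m_assoc h.H.inv_cancel_left)
  then have "(C \<otimes>\<^bsub>F\<^esub> inv\<^bsub>F\<^esub> D) [^]\<^bsub>F\<^esub> m = C [^]\<^bsub>F\<^esub> m \<otimes>\<^bsub>F\<^esub> (inv\<^bsub>F\<^esub> D) [^]\<^bsub>F\<^esub> m"
    using BC D by (intro h.H.pow_mult_distrib) auto
  also have "(inv\<^bsub>F\<^esub> D) [^]\<^bsub>F\<^esub> m = inv\<^bsub>F\<^esub> (B [^]\<^bsub>F\<^esub> (m * e))"
    using BC by (simp add: D_def h.H.nat_pow_inv h.H.nat_pow_pow mult.commute)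
  also have "C [^]\<^bsub>F\<^esub> m \<otimes>\<^bsub>F\<^esub> \<dots> = \<one>\<^bsub>F\<^esub>"
    unfolding CB using BC by simp
  finally have "h ((g \<otimes> inv (b [^] e)) [^] m) = \<one>\<^bsub>F\<^esub>"
    using bc g by (simp add: B_def C_def D_def h.hom_nat_pow)
  then have inW: "(g \<otimes> inv (b [^] e)) [^] m \<in> W"
    using W1 bc g by simp
  \<comment> \<open>The correcting factor is an \<open>e\<close>-th power so that it lies in
    \<open>N\<close>. Modulo \<open>N\<close> nothing changes, and the new \<open>m\<close>-th power
    is still in \<open>N\<close>, as a further correction requires.\<close>
  have "k (b [^] e) = \<one>\<^bsub>F'\<^esub>"
    using N1 e[OF b(1)] bc by simp
  then have "k (g \<otimes> inv (b [^] e)) = k g"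
    using bc g by simp
  then have "k ((g \<otimes> inv (b [^] e)) [^] m) = k (g [^] m)"
    using bc g by (simp add: k.hom_nat_pow del: k.hom_mult)
  then have "(g \<otimes> inv (b [^] e)) [^] m \<in> N"
    using N1 g bc by (metis inv_closed m_closed nat_pow_closed)
  then show ?thesis using inW by simp
qed

section \<open>Products of a subgroup with a normal subgroup\<close>

lemma (in group) normal_in_subgroupI:
  assumes K: "subgroup K G" and N: "subgroup N G" "N \<subseteq> K"
    and conj: "\<And>g x. g \<in> K \<Longrightarrow> x \<in> N \<Longrightarrow> g \<otimes> x \<otimes> inv g \<in> N"
  shows "N \<lhd> G\<lparr>carrier := K\<rparr>"
proof -
  interpret K: group "G\<lparr>carrier := K\<rparr>" by (rule subgroup_imp_group[OF K])
  show ?thesis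
    unfolding K.normal_inv_iff
    using subgroup_incl[OF N(1) K N(2)] conj m_inv_consistent[OF K] by simp
qed

text \<open>Conjugation by \<open>K\<close> preserves \<open>N\<close>, so \<open>K N\<close> is a
  group, and its index is finite because it contains \<open>N\<close>. With \<Gamma> for
  \<open>K\<close> it is the subgroup that the theorem asks for.\<close>

lemma (in group) finite_index_mult_normal:
  assumes H: "subgroup H G" and K: "subgroup K G" "K \<subseteq> H" and N: "normal_finite_index G H N"
  shows "finite_index_subgroup G H (K <#> N)" "K \<subseteq> K <#> N"
proof -
  note fi = normal_finite_indexD[OF H N]
  note sH = subgroup.subset[OF H]
  have Kc: "K \<subseteq> carrier G" and Nc: "N \<subseteq> carrier G"
    using K(2) fi(3) sH by auto
  have conj: "inv g \<otimes> x \<otimes> g \<in> N" if "g \<in> K" "x \<in> N" for g x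
  proof -
    have g: "g \<in> H" "g \<in> carrier G" using that(1) K(2) Kc by auto
    have "inv g \<otimes> x \<otimes> inv (inv g) \<in> N"
      by (intro fi(4) subgroup.m_inv_closed[OF H] g(1) that(2))
    then show ?thesis using g(2) by simp
  qed
  have mem: "k \<otimes> x \<in> K <#> N" if "k \<in> K" "x \<in> N" for k x
    using that by (auto simp: set_mult_def)
  show KKN: "K \<subseteq> K <#> N"
  proof
    fix k assume "k \<in> K"
    then show "k \<in> K <#> N"
      using mem[OF _ subgroup.one_closed[OF fi(2)], of k] Kc by auto
  qed
  have "N \<subseteq> K <#> N"
  proof
    fix x assume "x \<in> N"
    then show "x \<in> K <#> N"
      using mem[OF subgroup.one_closed[OF K(1)], of x] Nc by auto
  qed
  moreover have "K <#> N \<subseteq> H"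
    using K(2) fi(3) subgroup.m_closed[OF H] by (auto simp: set_mult_def)
  moreover have "subgroup (K <#> N) G"
  proof (rule subgroupI)
    show "K <#> N \<subseteq> carrier G" using \<open>K <#> N \<subseteq> H\<close> sH by blast
    show "K <#> N \<noteq> {}" using KKN subgroup.one_closed[OF K(1)] by blast
    fix a assume "a \<in> K <#> N"
    then obtain k x where a: "a = k \<otimes> x" "k \<in> K" "x \<in> N" by (auto simp: set_mult_def)
    have c: "k \<in> carrier G" "x \<in> carrier G" using a Kc Nc by auto
    have ik: "inv k \<in> K" using subgroup.m_inv_closed[OF K(1) a(2)] .
    have "inv k \<otimes> (inv (inv k) \<otimes> inv x \<otimes> inv k) \<in> K <#> N"
      by (intro mem ik conj[OF ik subgroup.m_inv_closed[OF fi(2) a(3)]])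
    moreover have "inv k \<otimes> (inv (inv k) \<otimes> inv x \<otimes> inv k) = inv a"
      using c a(1) by (simp add: inv_mult_group m_assoc inv_cancel_left)
    ultimately show "inv a \<in> K <#> N" by simp
    fix b assume "b \<in> K <#> N"
    then obtain l y where b: "b = l \<otimes> y" "l \<in> K" "y \<in> N" by (auto simp: set_mult_def)
    have d: "l \<in> carrier G" "y \<in> carrier G" using b Kc Nc by auto
    \<comment> \<open>Moving \<open>l\<close> to the left past \<open>x\<close> replaces
      \<open>x\<close> by the conjugate \<open>l^-1 x l\<close>, which is still in
      \<open>N\<close>.\<close>
    have "(k \<otimes> l) \<otimes> ((inv l \<otimes> x \<otimes> l) \<otimes> y) \<in> K <#> N"
      by (intro mem subgroup.m_closed[OF K(1)] subgroup.m_closed[OF fi(2)] conj a b)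
    moreover have "(k \<otimes> l) \<otimes> ((inv l \<otimes> x \<otimes> l) \<otimes> y) = a \<otimes> b"
      using c d a(1) b(1) inv_cancel_left[of "inv l" "x \<otimes> (l \<otimes> y)"] by (simp add: m_assoc)
    ultimately show "a \<otimes> b \<in> K <#> N" by simp
  qed
  ultimately show "finite_index_subgroup G H (K <#> N)"
    by (intro finite_index_subgroup_mono[OF H fi(1)])
qed

section \<open>Congruence subgroups\<close>

lemma mult_GL [simp]: "A \<otimes>\<^bsub>GL n\<^esub> B = A * B"
  by (simp add: GL_def units_of_mult ring_mat_simps)

lemma one_GL [simp]: "\<one>\<^bsub>GL n\<^esub> = 1\<^sub>m n"
  by (simp add: GL_def units_of_one ring_mat_simps)

lemma group_GL: "group (GL n)"
proof -
  interpret ring "ring_mat TYPE(complex) n ()" by (rule ring_mat)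
  show ?thesis unfolding GL_def by (rule units_group)
qed

lemma GL_carrier_mat: "A \<in> carrier (GL n) \<Longrightarrow> A \<in> carrier_mat n n"
  by (auto simp: GL_def units_of_carrier Units_def ring_mat_simps)

lemma GL_inv:
  assumes "A \<in> carrier (GL n)"
  shows "inv\<^bsub>GL n\<^esub> A \<in> carrier_mat n n" "inv\<^bsub>GL n\<^esub> A * A = 1\<^sub>m n" "A * inv\<^bsub>GL n\<^esub> A = 1\<^sub>m n"
  using group.inv_closed[OF group_GL assms] group.l_inv[OF group_GL assms]
    group.r_inv[OF group_GL assms] GL_carrier_mat by auto

lemma GL_pow: "A \<in> carrier (GL n) \<Longrightarrow> A [^]\<^bsub>GL n\<^esub> k = A ^\<^sub>m k"
  using GL_carrier_mat by (induction k) (auto simp: nat_pow_def)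

section \<open>Integral matrices and reduction modulo an integer\<close>

definition int_mat :: "nat \<Rightarrow> complex mat set" where
  "int_mat n = {A \<in> carrier_mat n n. \<forall>i<n. \<forall>j<n. A $$ (i, j) \<in> \<int>}"

lemma int_mat_carrier: "A \<in> int_mat n \<Longrightarrow> A \<in> carrier_mat n n"
  by (simp add: int_mat_def)

lemma int_mat_entry: "A \<in> int_mat n \<Longrightarrow> i < n \<Longrightarrow> j < n \<Longrightarrow> A $$ (i, j) \<in> \<int>"
  by (simp add: int_mat_def)

lemma int_mat_one: "1\<^sub>m n \<in> int_mat n"
  by (auto simp: int_mat_def one_mat_def)

lemma int_mat_uminus: "A \<in> int_mat n \<Longrightarrow> - A \<in> int_mat n"
  by (auto simp: int_mat_def)

lemma int_mat_add: "A \<in> int_mat n \<Longrightarrow> B \<in> int_mat n \<Longrightarrow> A + B \<in> int_mat n"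
  by (auto simp: int_mat_def)

lemma int_mat_mult: "A \<in> int_mat n \<Longrightarrow> B \<in> int_mat n \<Longrightarrow> A * B \<in> int_mat n"
  by (auto simp: int_mat_def scalar_prod_def intro!: Ints_sum Ints_mult)

lemma GL_Ints_iff: "A \<in> GL_Ints n \<longleftrightarrow> A \<in> carrier (GL n) \<and> A \<in> int_mat n \<and> inv\<^bsub>GL n\<^esub> A \<in> int_mat n"
  using GL_carrier_mat GL_inv(1) by (auto simp: GL_Ints_def int_mat_def)

lemma subgroup_GL_Ints: "subgroup (GL_Ints n) (GL n)"
proof (rule group.subgroupI[OF group_GL])
  show "GL_Ints n \<subseteq> carrier (GL n)" by (auto simp: GL_Ints_iff)
  have "\<one>\<^bsub>GL n\<^esub> \<in> GL_Ints n"
    unfolding GL_Ints_iff monoid.inv_one[OF group.is_monoid[OF group_GL]]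
    using group.is_monoid[OF group_GL, THEN monoid.one_closed] int_mat_one by auto
  then show "GL_Ints n \<noteq> {}" by blast
  fix a assume a: "a \<in> GL_Ints n"
  then show "inv\<^bsub>GL n\<^esub> a \<in> GL_Ints n"
    using group.inv_closed[OF group_GL] group.inv_inv[OF group_GL] by (auto simp: GL_Ints_iff)
  fix b assume b: "b \<in> GL_Ints n"
  have "a \<otimes>\<^bsub>GL n\<^esub> b \<in> carrier (GL n)"
    using a b group.is_monoid[OF group_GL, THEN monoid.m_closed] by (auto simp: GL_Ints_iff)
  moreover have "inv\<^bsub>GL n\<^esub> (a \<otimes>\<^bsub>GL n\<^esub> b) = inv\<^bsub>GL n\<^esub> b \<otimes>\<^bsub>GL n\<^esub> inv\<^bsub>GL n\<^esub> a"
    using a b by (intro group.inv_mult_group[OF group_GL]) (auto simp: GL_Ints_iff)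
  ultimately show "a \<otimes>\<^bsub>GL n\<^esub> b \<in> GL_Ints n"
    using a b int_mat_mult unfolding GL_Ints_iff by simp
qed

text \<open>The principal congruence subgroup of level \<open>M\<close>, that is, the kernel of
  reduction modulo \<open>M\<close>. The explicit \<open>Z\<close> is what the trace comparison and
  the divisibility argument work with.\<close>

definition congruence_subgroup :: "nat \<Rightarrow> int \<Rightarrow> complex mat set" where
  "congruence_subgroup n M = {A \<in> GL_Ints n. \<exists>Z\<in>int_mat n. A = 1\<^sub>m n + of_int M \<cdot>\<^sub>m Z}"

lemma mult_congruence_expand:
  fixes A Z :: "complex mat"
  assumes "A \<in> carrier_mat n n" "Z \<in> carrier_mat n n"
  shows "A * (1\<^sub>m n + c \<cdot>\<^sub>m Z) = A + c \<cdot>\<^sub>m (A * Z)"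
  using assms by (subst mult_add_distrib_mat[of _ n n _ n]) (auto simp: mult_smult_distrib[of _ n n _ n])

lemma subgroup_congruence_subgroup: "subgroup (congruence_subgroup n M) (GL n)"
proof (rule group.subgroupI[OF group_GL])
  let ?G = "GL n"
  show "congruence_subgroup n M \<subseteq> carrier ?G"
    by (auto simp: congruence_subgroup_def GL_Ints_iff)
  have "0\<^sub>m n n \<in> int_mat n" by (auto simp: int_mat_def)
  moreover have "1\<^sub>m n = 1\<^sub>m n + complex_of_int M \<cdot>\<^sub>m 0\<^sub>m n n" by (intro eq_matI) auto
  ultimately have "\<one>\<^bsub>?G\<^esub> \<in> congruence_subgroup n M"
    using subgroup.one_closed[OF subgroup_GL_Ints, of n]
    unfolding congruence_subgroup_def one_GL by blast
  then show "congruence_subgroup n M \<noteq> {}" by blast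
  fix a assume a: "a \<in> congruence_subgroup n M"
  then obtain Z where Z: "Z \<in> int_mat n" "a = 1\<^sub>m n + of_int M \<cdot>\<^sub>m Z" and aI: "a \<in> GL_Ints n"
    by (auto simp: congruence_subgroup_def)
  have ac: "a \<in> carrier ?G" using aI by (simp add: GL_Ints_iff)
  note inv = GL_inv[OF ac] and Zc = int_mat_carrier[OF Z(1)]
  have aiI: "inv\<^bsub>?G\<^esub> a \<in> GL_Ints n" using subgroup.m_inv_closed[OF subgroup_GL_Ints aI] .
  \<comment> \<open>Expanding \<open>a^-1 a = 1\<close> with \<open>a = 1 + M Z\<close> exhibits
    \<open>a^-1\<close> as \<open>1 + M (- a^-1 Z)\<close>.\<close>
  have "1\<^sub>m n = inv\<^bsub>?G\<^esub> a + of_int M \<cdot>\<^sub>m (inv\<^bsub>?G\<^esub> a * Z)"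
    using inv(2) mult_congruence_expand[OF inv(1) Zc] Z(2) by simp
  then have "inv\<^bsub>?G\<^esub> a = 1\<^sub>m n + of_int M \<cdot>\<^sub>m (- (inv\<^bsub>?G\<^esub> a * Z))"
    using inv(1) Zc by (auto simp: mat_eq_iff eq_diff_eq[symmetric])
  moreover have "- (inv\<^bsub>?G\<^esub> a * Z) \<in> int_mat n"
    using aiI Z(1) by (intro int_mat_uminus int_mat_mult) (auto simp: GL_Ints_iff)
  ultimately show "inv\<^bsub>?G\<^esub> a \<in> congruence_subgroup n M"
    using aiI by (auto simp: congruence_subgroup_def)
  fix b assume b: "b \<in> congruence_subgroup n M"
  then obtain Y where Y: "Y \<in> int_mat n" "b = 1\<^sub>m n + of_int M \<cdot>\<^sub>m Y" and bI: "b \<in> GL_Ints n"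
    by (auto simp: congruence_subgroup_def)
  note Yc = int_mat_carrier[OF Y(1)]
  have "a * b = a + of_int M \<cdot>\<^sub>m (a * Y)"
    unfolding Y(2) by (rule mult_congruence_expand[OF GL_carrier_mat[OF ac] Yc])
  also have "\<dots> = 1\<^sub>m n + of_int M \<cdot>\<^sub>m (Z + a * Y)"
    using Zc Yc GL_carrier_mat[OF ac] Z(2) by (auto simp: mat_eq_iff algebra_simps)
  finally have "a * b = 1\<^sub>m n + of_int M \<cdot>\<^sub>m (Z + a * Y)" .
  moreover have "Z + a * Y \<in> int_mat n"
    using aI Z(1) Y(1) by (intro int_mat_add int_mat_mult) (auto simp: GL_Ints_iff)
  moreover have "a \<otimes>\<^bsub>?G\<^esub> b \<in> GL_Ints n" using subgroup.m_closed[OF subgroup_GL_Ints aI bI] .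
  ultimately show "a \<otimes>\<^bsub>?G\<^esub> b \<in> congruence_subgroup n M"
    by (auto simp: congruence_subgroup_def)
qed

lemma finite_index_congruence_subgroup:
  assumes "M > 0"
  shows "finite_index_subgroup (GL n) (GL_Ints n) (congruence_subgroup n M)"
proof -
  let ?S = "{..<n} \<times> {..<n}"
  \<comment> \<open>Reduction of the entries modulo \<open>M\<close>; for an integral matrix the
    floor of the real part is the entry itself, as an \<open>int\<close>.\<close>
  define f where "f A = restrict (\<lambda>ij. \<lfloor>Re (A $$ ij)\<rfloor> mod M) ?S" for A :: "complex mat"
  show ?thesis
  proof (rule group.finite_index_subgroupI[OF group_GL subgroup_GL_Ints subgroup_congruence_subgroup,
        where f = f])
    show "congruence_subgroup n M \<subseteq> GL_Ints n" by (auto simp: congruence_subgroup_def)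
    have "f ` GL_Ints n \<subseteq> ?S \<rightarrow>\<^sub>E {0..<M}"
      unfolding image_subset_iff f_def restrict_PiE_iff using assms by simp
    moreover have "finite (?S \<rightarrow>\<^sub>E {0..<M})" by (intro finite_PiE) auto
    ultimately show "finite (f ` GL_Ints n)" by (rule finite_subset)
    fix x y assume x: "x \<in> GL_Ints n" and y: "y \<in> GL_Ints n" and eq: "f x = f y"
    have xc: "x \<in> carrier_mat n n" and yc: "y \<in> carrier_mat n n"
      using x y GL_carrier_mat by (auto simp: GL_Ints_iff)
    \<comment> \<open>The entrywise quotient of \<open>x - y\<close> by \<open>M\<close>, so that
      \<open>x = y + M Z\<close> and hence \<open>x y^-1 = 1 + M (Z y^-1)\<close>.\<close>
    define Z where "Z = mat n n (\<lambda>ij. complex_of_int ((\<lfloor>Re (x $$ ij)\<rfloor> - \<lfloor>Re (y $$ ij)\<rfloor>) div M))"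
    have Z: "Z \<in> int_mat n" by (auto simp: Z_def int_mat_def)
    note Zc = int_mat_carrier[OF Z]
    have "x $$ (i, j) = y $$ (i, j) + of_int M * Z $$ (i, j)" if ij: "i < n" "j < n" for i j
    proof -
      obtain k l where kl: "x $$ (i, j) = of_int k" "y $$ (i, j) = of_int l"
        using int_mat_entry[of x n i j] int_mat_entry[of y n i j] x y ij
        by (auto simp: GL_Ints_iff elim!: Ints_cases)
      have "k mod M = l mod M" using fun_cong[OF eq, of "(i, j)"] ij kl by (simp add: f_def)
      then have "M dvd k - l" by (simp add: mod_eq_dvd_iff)
      then have "k = l + M * ((k - l) div M)" by simp
      then have "complex_of_int k = of_int (l + M * ((k - l) div M))" by presburger
      moreover have "Z $$ (i, j) = of_int ((k - l) div M)" using ij by (simp add: Z_def kl)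
      ultimately show ?thesis using kl by simp
    qed
    then have "x = y + of_int M \<cdot>\<^sub>m Z" using xc yc Zc by (auto simp: mat_eq_iff)
    moreover have yG: "y \<in> carrier (GL n)" using y by (simp add: GL_Ints_iff)
    ultimately have "x * inv\<^bsub>GL n\<^esub> y = 1\<^sub>m n + of_int M \<cdot>\<^sub>m (Z * inv\<^bsub>GL n\<^esub> y)"
      using GL_inv[OF yG] yc Zc
      by (simp add: add_mult_distrib_mat[of _ n n _ _ n] mult_smult_assoc_mat[of _ n n _ n])
    moreover have "Z * inv\<^bsub>GL n\<^esub> y \<in> int_mat n"
      using Z y by (intro int_mat_mult) (auto simp: GL_Ints_iff)
    moreover have "x \<otimes>\<^bsub>GL n\<^esub> inv\<^bsub>GL n\<^esub> y \<in> GL_Ints n"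
      using x y subgroup_GL_Ints by (intro subgroup.m_closed subgroup.m_inv_closed)
    ultimately show "x \<otimes>\<^bsub>GL n\<^esub> inv\<^bsub>GL n\<^esub> y \<in> congruence_subgroup n M"
      by (auto simp: congruence_subgroup_def)
  qed
qed

section \<open>Deep normal subgroups of an arithmetic lattice\<close>

lemma arithmetic_lattice_subgroup: "arithmetic_lattice n \<Lambda> \<Longrightarrow> subgroup \<Lambda> (GL n)"
  by (auto simp: arithmetic_lattice_def)

text \<open>Commensurability makes the integral points of finite index in \<Lambda>; cutting them
  down by the congruence subgroup keeps the index finite, and the normal core finishes.\<close>

lemma arithmetic_lattice_congruence:
  assumes "arithmetic_lattice n \<Lambda>" "M > 0"
  obtains N where "normal_finite_index (GL n) \<Lambda> N" "N \<subseteq> congruence_subgroup n M"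
proof -
  note L = arithmetic_lattice_subgroup[OF assms(1)]
  obtain G where "commensurable (GL n) \<Lambda> (G \<inter> GL_Ints n)"
    using assms(1) unfolding arithmetic_lattice_def by blast
  then have c: "finite_index_subgroup (GL n) \<Lambda> (\<Lambda> \<inter> (G \<inter> GL_Ints n))"
    by (simp add: commensurable_def)
  let ?L = "\<Lambda> \<inter> (G \<inter> GL_Ints n)"
  have "?L \<subseteq> GL_Ints n" by auto
  with group.finite_index_subgroupD(1)[OF group_GL L c]
  have "finite_index_subgroup (GL n) ?L (?L \<inter> congruence_subgroup n M)"
    by (rule group.finite_index_subgroup_restrict[OF group_GL subgroup_GL_Ints
          finite_index_congruence_subgroup[OF assms(2)]])
  then have "finite_index_subgroup (GL n) \<Lambda> (?L \<inter> congruence_subgroup n M)"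
    by (rule group.finite_index_subgroup_trans[OF group_GL L c])
  then obtain N
    where "normal_finite_index (GL n) \<Lambda> N" "N \<subseteq> ?L \<inter> congruence_subgroup n M"
    by (rule group.normal_core[OF group_GL L])
  then show thesis by (intro that) auto
qed

section \<open>Traces of semisimple and unipotent matrices\<close>

text \<open>By linearity the sum of \<open>p (l i)\<close> is \<open>n * p 1\<close> for every
  polynomial \<open>p\<close>. If \<open>l j\<close> were not 1, a polynomial vanishing at 1 and at
  all values of \<open>l\<close> other than \<open>l j\<close> would give 0 on the right, but on the
  left a positive multiplicity times the nonzero \<open>p (l j)\<close>.\<close>

lemma power_sums_eq_one:
  fixes l :: "nat \<Rightarrow> complex"
  assumes sums: "\<And>k. (\<Sum>i<n. l i ^ k) = of_nat n" and "j < n"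
  shows "l j = 1"
proof (rule ccontr)
  assume ne: "l j \<noteq> 1"
  \<comment> \<open>The prescribed roots; 1 is among them because \<open>l j\<close> is assumed
    different from 1.\<close>
  define S where "S = insert 1 (l ` {..<n}) - {l j}"
  define p where "p = (\<Prod>s\<in>S. [:- s, 1:])"
  have fin: "finite S" by (simp add: S_def)
  have p_eval: "poly p x = (\<Prod>s\<in>S. x - s)" for x by (simp add: p_def poly_prod)
  have "(\<Sum>i<n. poly p (l i)) = (\<Sum>k\<le>degree p. coeff p k * (\<Sum>i<n. l i ^ k))"
    by (simp add: poly_altdef sum_distrib_left) (rule sum.swap)
  also have "\<dots> = of_nat n * poly p 1"
    by (simp add: sums poly_altdef sum_distrib_left mult.commute)
  also have "poly p 1 = 0" using fin ne by (auto simp: p_eval S_def)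
  finally have 0: "(\<Sum>i<n. poly p (l i)) = 0" by simp
  have "poly p (l i) = (if l i = l j then poly p (l j) else 0)" if "i < n" for i
    using fin that by (auto simp: p_eval S_def)
  then have "(\<Sum>i<n. poly p (l i)) = (\<Sum>i<n. if l i = l j then poly p (l j) else 0)"
    by (intro sum.cong) auto
  also have "\<dots> = of_nat (card {i\<in>{..<n}. l i = l j}) * poly p (l j)"
    by (simp add: sum.If_cases Int_def)
  finally have "card {i\<in>{..<n}. l i = l j} = 0 \<or> poly p (l j) = 0" using 0 by simp
  moreover have "j \<in> {i\<in>{..<n}. l i = l j}" using \<open>j < n\<close> by simp
  then have "card {i\<in>{..<n}. l i = l j} \<noteq> 0" by (subst card_0_eq) auto
  moreover have "poly p (l j) \<noteq> 0" using fin by (simp add: p_eval S_def)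
  ultimately show False by blast
qed

definition mat_trace :: "complex mat \<Rightarrow> complex" where
  "mat_trace A = (\<Sum>i<dim_row A. A $$ (i, i))"

lemma mat_trace_mult_commute:
  assumes "A \<in> carrier_mat n n" "B \<in> carrier_mat n n"
  shows "mat_trace (A * B) = mat_trace (B * A)"
proof -
  have "mat_trace (A * B) = (\<Sum>i<n. \<Sum>k<n. A $$ (i, k) * B $$ (k, i))"
    using assms by (simp add: mat_trace_def scalar_prod_def lessThan_atLeast0)
  also have "\<dots> = (\<Sum>k<n. \<Sum>i<n. B $$ (k, i) * A $$ (i, k))"
    by (subst sum.swap) (simp add: mult.commute)
  also have "\<dots> = mat_trace (B * A)"
    using assms by (simp add: mat_trace_def scalar_prod_def lessThan_atLeast0)
  finally show ?thesis .
qed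

lemma mat_trace_similar:
  assumes "similar_mat_wit A B P Q"
  shows "mat_trace A = mat_trace B"
proof -
  define n where "n = dim_row A"
  note s = similar_mat_witD[OF n_def assms]
  have "mat_trace A = mat_trace (P * (B * Q))"
    using s by (simp add: assoc_mult_mat[of _ n n _ n _ n])
  also have "\<dots> = mat_trace (B * Q * P)"
    using s by (intro mat_trace_mult_commute[of _ n]) auto
  also have "B * Q * P = B" using s by (simp add: assoc_mult_mat[of _ n n _ n _ n])
  finally show ?thesis .
qed

lemma diagonal_mat_pow:
  assumes "diagonal_mat D" "D \<in> carrier_mat n n" "i < n" "j < n"
  shows "(D ^\<^sub>m k) $$ (i, j) = (if i = j then (D $$ (i, i)) ^ k else 0)"
  using assms(3,4)
proof (induction k arbitrary: i j)
  case 0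
  then show ?case using assms(2) by simp
next
  case (Suc k)
  have "(D ^\<^sub>m Suc k) $$ (i, j) = (\<Sum>l<n. (D ^\<^sub>m k) $$ (i, l) * D $$ (l, j))"
    using assms(2) Suc by (simp add: scalar_prod_def lessThan_atLeast0)
  also have "\<dots> = (\<Sum>l<n. if l = i then (D $$ (i, i)) ^ k * D $$ (i, j) else 0)"
    using Suc by (intro sum.cong) auto
  also have "\<dots> = (if i = j then (D $$ (i, i)) ^ Suc k else 0)"
    using assms(1,2) Suc.prems by (cases "i = j") (simp_all add: diagonal_mat_def power_commutes)
  finally show ?case .
qed

lemma semisimple_matE:
  assumes "semisimple_mat A"
  obtains D P Q where "diagonal_mat D" "similar_mat_wit A D P Q"
  using assms unfolding semisimple_mat_def similar_mat_def by (elim exE conjE)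

lemma semisimple_mat_pow:
  assumes "semisimple_mat A"
  shows "semisimple_mat (A ^\<^sub>m k)"
proof -
  obtain D P Q where D: "diagonal_mat D" and w: "similar_mat_wit A D P Q"
    using assms by (rule semisimple_matE)
  define n where "n = dim_row A"
  have Dc: "D \<in> carrier_mat n n" using similar_mat_witD[OF n_def w] by simp
  have "diagonal_mat (D ^\<^sub>m k)"
    using diagonal_mat_pow[OF D Dc] Dc by (auto simp: diagonal_mat_def)
  moreover have "similar_mat (A ^\<^sub>m k) (D ^\<^sub>m k)"
    unfolding similar_mat_def using similar_mat_wit_pow[OF w] by blast
  ultimately show ?thesis unfolding semisimple_mat_def by (intro exI conjI)
qed

text \<open>The traces of the powers are the power sums of the eigenvalues, so all eigenvalues are
  1, and a diagonalizable matrix with this sole eigenvalue is the identity.\<close>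

lemma semisimple_trace_powers:
  assumes A: "semisimple_mat A" "A \<in> carrier_mat n n" and tr: "\<And>k. mat_trace (A ^\<^sub>m k) = of_nat n"
  shows "A = 1\<^sub>m n"
proof -
  obtain D P Q where D: "diagonal_mat D" and w: "similar_mat_wit A D P Q"
    using A(1) by (rule semisimple_matE)
  note s = similar_mat_witD2[OF A(2) w]
  have "(\<Sum>i<n. (D $$ (i, i)) ^ k) = of_nat n" for k
  proof -
    have "of_nat n = mat_trace (D ^\<^sub>m k)"
      using mat_trace_similar[OF similar_mat_wit_pow[OF w, of k]] tr by simp
    also have "\<dots> = (\<Sum>i<n. (D $$ (i, i)) ^ k)"
      using s diagonal_mat_pow[OF D s(5)] by (simp add: mat_trace_def)
    finally show ?thesis by simp
  qed
  then have "D $$ (i, i) = 1" if "i < n" for i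
    using power_sums_eq_one[where l = "\<lambda>i. D $$ (i, i)" and n = n] that by blast
  then have "D = 1\<^sub>m n" using D s by (intro eq_matI) (auto simp: diagonal_mat_def)
  then show ?thesis using s by simp
qed

text \<open>Conjugation preserves the trace, which on a unitriangular matrix just counts the
  diagonal ones.\<close>

lemma unipotent_subgroup_trace:
  assumes U: "unipotent_subgroup n U" and u: "u \<in> U"
  shows "mat_trace u = of_nat n"
proof -
  obtain P where P: "P \<in> carrier (GL n)" "P * u * inv\<^bsub>GL n\<^esub> P \<in> upper_unitriangular n"
    using U u unfolding unipotent_subgroup_def mult_GL by blast
  have uc: "u \<in> carrier_mat n n"
    using U u GL_carrier_mat subgroup.subset[of U "GL n"] by (auto simp: unipotent_subgroup_def)
  let ?T = "P * u * inv\<^bsub>GL n\<^esub> P"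
  note Pc = GL_carrier_mat[OF P(1)] and i = GL_inv[OF P(1)]
  have "similar_mat_wit ?T u P (inv\<^bsub>GL n\<^esub> P)"
    using Pc i uc by (intro similar_mat_witI[of _ _ n]) auto
  then have "mat_trace u = mat_trace ?T" by (simp add: mat_trace_similar)
  also have "\<dots> = (\<Sum>i<n. 1)"
    unfolding mat_trace_def using P(2) Pc by (intro sum.cong) (auto simp: upper_unitriangular_def)
  finally show ?thesis by simp
qed

section \<open>Separating a semisimple element from a unipotent group by traces\<close>

lemma (in group) subgroup_nat_pow_closed:
  assumes "subgroup H G" "x \<in> H"
  shows "x [^] (k::nat) \<in> H"
  using subgroup.one_closed[OF assms(1)] subgroup.m_closed[OF assms(1) _ assms(2)]
  by (induction k) simp_all

text \<open>Moving a factor from \<open>N\<close> to the right past \<open>u\<close> conjugates it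
  within \<open>N\<close>. This carries a relation modulo \<open>N\<close> over to powers.\<close>

lemma (in group) mult_pow_coset:
  assumes N: "subgroup N G" and u: "u \<in> carrier G" and x: "x \<in> N"
    and conj: "\<And>y. y \<in> N \<Longrightarrow> inv u \<otimes> y \<otimes> u \<in> N"
  shows "\<exists>y\<in>N. (u \<otimes> x) [^] (k::nat) = u [^] k \<otimes> y"
proof (induction k)
  case 0
  then show ?case using subgroup.one_closed[OF N] by (intro bexI[of _ \<one>]) auto
next
  case (Suc k)
  then obtain y where y: "y \<in> N" "(u \<otimes> x) [^] k = u [^] k \<otimes> y" by (rule bexE)
  have c: "y \<in> carrier G" "x \<in> carrier G" using y(1) x subgroup.subset[OF N] by auto
  have "(u \<otimes> x) [^] Suc k = u [^] Suc k \<otimes> (inv u \<otimes> y \<otimes> u \<otimes> x)"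
    using c u y(2) inv_cancel_left[of "inv u" "y \<otimes> (u \<otimes> x)"] by (simp add: m_assoc)
  moreover have "inv u \<otimes> y \<otimes> u \<otimes> x \<in> N"
    using subgroup.m_closed[OF N conj[OF y(1)] x] .
  ultimately show ?case by blast
qed

text \<open>Some power of \<theta> has a trace that differs from \<open>n\<close> by a nonzero
  \<open>a\<close>. If a conjugate of \<theta> were \<open>u x\<close>, the corresponding power of
  \<open>u x\<close> would be an element of \<open>U\<close> times one of \<open>N\<close>, with
  trace congruent to \<open>n\<close> modulo \<open>M\<close>; so \<open>a\<close> would be a
  nonzero multiple of \<open>M\<close>, although \<open>M\<close> exceeds its modulus.\<close>

lemma separate_semisimple_from_unipotent:
  assumes L: "arithmetic_lattice n \<Lambda>" and U: "unipotent_subgroup n U" "U \<subseteq> \<Lambda>" "U \<subseteq> GL_Ints n"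
    and \<theta>: "\<theta> \<in> \<Lambda>" "semisimple_mat \<theta>" "\<theta> \<noteq> 1\<^sub>m n"
  obtains N where "normal_finite_index (GL n) \<Lambda> N"
    "\<And>h u x. h \<in> \<Lambda> \<Longrightarrow> u \<in> U \<Longrightarrow> x \<in> N \<Longrightarrow> h * \<theta> * inv\<^bsub>GL n\<^esub> h \<noteq> u * x"
proof -
  interpret G: group "GL n" by (rule group_GL)
  note sL = arithmetic_lattice_subgroup[OF L]
  have LG: "\<Lambda> \<subseteq> carrier (GL n)" using subgroup.subset[OF sL] .
  have sU: "subgroup U (GL n)" using U(1) by (simp add: unipotent_subgroup_def)
  have \<theta>c: "\<theta> \<in> carrier (GL n)" using \<theta> LG by blast
  obtain k where k: "mat_trace (\<theta> ^\<^sub>m k) \<noteq> of_nat n"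
    using semisimple_trace_powers[OF \<theta>(2) GL_carrier_mat[OF \<theta>c]] \<theta>(3) by blast
  define a where "a = mat_trace (\<theta> ^\<^sub>m k) - of_nat n"
  \<comment> \<open>The added 1 makes \<open>M\<close> positive and strictly larger than the modulus
    of \<open>a\<close>.\<close>
  define M where "M = \<lfloor>cmod a\<rfloor> + 1"
  have "0 \<le> \<lfloor>cmod a\<rfloor>" by simp
  then have M: "M > 0" "cmod a < of_int M" unfolding M_def by (linarith, linarith)
  obtain N where N: "normal_finite_index (GL n) \<Lambda> N" "N \<subseteq> congruence_subgroup n M"
    using arithmetic_lattice_congruence[OF L M(1)] .
  note Nfi = G.normal_finite_indexD[OF sL N(1)]
  note sN = Nfi(2)
  have False if h: "h \<in> \<Lambda>" and u: "u \<in> U" and x: "x \<in> N" and eq: "h * \<theta> * inv\<^bsub>GL n\<^esub> h = u * x" for h u x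
  proof -
    have hc: "h \<in> carrier (GL n)" using h LG by blast
    have uc: "u \<in> carrier (GL n)" using u subgroup.subset[OF sU] by blast
    have xc: "x \<in> carrier (GL n)" using x subgroup.subset[OF sN] by blast
    have "u \<in> \<Lambda>" using u U(2) by blast
    then have "inv\<^bsub>GL n\<^esub> u \<otimes>\<^bsub>GL n\<^esub> y \<otimes>\<^bsub>GL n\<^esub> inv\<^bsub>GL n\<^esub> (inv\<^bsub>GL n\<^esub> u) \<in> N" if "y \<in> N" for y
      by (intro Nfi(4) that subgroup.m_inv_closed[OF sL])
    then have "\<exists>y\<in>N. (u \<otimes>\<^bsub>GL n\<^esub> x) [^]\<^bsub>GL n\<^esub> k = u [^]\<^bsub>GL n\<^esub> k \<otimes>\<^bsub>GL n\<^esub> y"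
      using uc by (intro G.mult_pow_coset[OF sN uc x]) simp
    then obtain y where y: "y \<in> N" "(u \<otimes>\<^bsub>GL n\<^esub> x) [^]\<^bsub>GL n\<^esub> k = u [^]\<^bsub>GL n\<^esub> k \<otimes>\<^bsub>GL n\<^esub> y"
      by blast
    define v where "v = u [^]\<^bsub>GL n\<^esub> k"
    have v: "v \<in> U" unfolding v_def
      by (rule G.subgroup_nat_pow_closed[OF sU u])
    obtain Z where Z: "Z \<in> int_mat n" "y = 1\<^sub>m n + of_int M \<cdot>\<^sub>m Z"
      using y(1) N(2) by (auto simp: congruence_subgroup_def)
    \<comment> \<open>Integrality of \<open>U\<close> enters here: it makes \<open>v * Z\<close>
      integral, so that the trace of \<open>v y\<close> differs from that of \<open>v\<close> by an
      integer multiple of \<open>M\<close>.\<close>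
    have vI: "v \<in> int_mat n" using v U(3) by (auto simp: GL_Ints_iff)
    have vc: "v \<in> carrier_mat n n" by (rule int_mat_carrier[OF vI])
    have vZ: "v * Z \<in> int_mat n" using vI Z(1) by (rule int_mat_mult)
    have "(u * x) ^\<^sub>m k = v * y"
      using y(2) G.m_closed[OF uc xc] by (simp add: GL_pow v_def)
    also have "\<dots> = v + of_int M \<cdot>\<^sub>m (v * Z)"
      unfolding Z(2) by (rule mult_congruence_expand[OF vc int_mat_carrier[OF Z(1)]])
    finally have ux: "(u * x) ^\<^sub>m k = v + of_int M \<cdot>\<^sub>m (v * Z)" .
    have "similar_mat_wit (u * x) \<theta> h (inv\<^bsub>GL n\<^esub> h)"
      unfolding eq[symmetric] using GL_carrier_mat[OF hc] GL_inv[OF hc] GL_carrier_mat[OF \<theta>c]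
      by (intro similar_mat_witI[of _ _ n]) auto
    then have "mat_trace (\<theta> ^\<^sub>m k) = mat_trace ((u * x) ^\<^sub>m k)"
      by (rule mat_trace_similar[OF similar_mat_wit_pow, symmetric])
    also have "\<dots> = mat_trace v + of_int M * mat_trace (v * Z)"
      unfolding ux using vc int_mat_carrier[OF vZ]
      by (simp add: mat_trace_def sum.distrib sum_distrib_left del: index_mult_mat)
    also have "mat_trace v = of_nat n" by (rule unipotent_subgroup_trace[OF U(1) v])
    finally have a: "a = of_int M * mat_trace (v * Z)" by (simp add: a_def)
    have "mat_trace (v * Z) \<in> \<int>"
      unfolding mat_trace_def using vZ int_mat_carrier[OF vZ]
      by (intro Ints_sum) (auto simp: int_mat_def)
    then obtain t where "mat_trace (v * Z) = of_int t" by (auto elim: Ints_cases)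
    then have at: "a = of_int (M * t)" using a by simp
    have "a \<noteq> 0" using k by (simp add: a_def)
    then have "\<bar>t\<bar> \<ge> 1" using at by auto
    then have "M \<le> M * \<bar>t\<bar>" using M(1) by simp
    moreover have "cmod a = of_int (M * \<bar>t\<bar>)"
      unfolding at using M(1) by (simp only: norm_of_int abs_mult of_int_abs[symmetric] abs_of_pos)
    ultimately show False using M(2) by linarith
  qed
  then show thesis using that N(1) by blast
qed

section \<open>A central filtration of a unipotent group\<close>

text \<open>For lists of length \<open>k\<close> over a group \<open>U\<close> these products span
  the \<open>k\<close>-th power of the augmentation ideal of \<open>U\<close>, represented by
  matrices.\<close>

fun diff_prod :: "nat \<Rightarrow> complex mat list \<Rightarrow> complex mat" where
  "diff_prod n [] = 1\<^sub>m n"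
| "diff_prod n (x # xs) = (x - 1\<^sub>m n) * diff_prod n xs"

lemma diff_prod_carrier:
  "set xs \<subseteq> carrier_mat n n \<Longrightarrow> diff_prod n xs \<in> carrier_mat n n"
  by (induction xs) auto

lemma diff_one_mult_carrier:
  fixes P :: "complex mat"
  assumes "P \<in> carrier_mat n n"
  shows "(x - 1\<^sub>m n) * P \<in> carrier_mat n n"
  using assms by (intro carrier_matI) simp_all

lemma one_diff_one_mult:
  fixes P :: "complex mat"
  assumes "P \<in> carrier_mat n n"
  shows "(1\<^sub>m n - 1\<^sub>m n) * P = 0\<^sub>m n n"
  using assms by (simp add: minus_mult_distrib_mat[of _ n n] minus_r_inv_mat)

text \<open>The group ring identity \<open>x y - 1 = x (y - 1) + (x - 1)\<close>, with a right
  factor \<open>P\<close> because the filtration only controls such products.\<close>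

lemma mult_diff_one:
  fixes x y P :: "complex mat"
  assumes "x \<in> carrier_mat n n" "y \<in> carrier_mat n n" "P \<in> carrier_mat n n"
  shows "(x * y - 1\<^sub>m n) * P = x * ((y - 1\<^sub>m n) * P) + (x - 1\<^sub>m n) * P"
proof -
  have "(x * y - 1\<^sub>m n) * P = x * (y * P) - P"
    using assms by (simp add: minus_mult_distrib_mat[of _ n n] assoc_mult_mat[of _ n n _ n _ n])
  moreover have "x * ((y - 1\<^sub>m n) * P) = x * (y * P) - x * P"
    using assms by (simp add: minus_mult_distrib_mat[of _ n n] mult_minus_distrib_mat[of _ n n _ n])
  moreover have "(x - 1\<^sub>m n) * P = x * P - P"
    using assms by (simp add: minus_mult_distrib_mat[of _ n n])
  ultimately show ?thesis
    using assms by (intro eq_matI) (simp_all del: index_mult_mat(1))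
qed

lemma conj_diff_one:
  fixes x :: "complex mat"
  assumes g: "g \<in> carrier (GL n)" and x: "x \<in> carrier_mat n n"
  shows "g * x * inv\<^bsub>GL n\<^esub> g - 1\<^sub>m n = g * (x - 1\<^sub>m n) * inv\<^bsub>GL n\<^esub> g"
  using GL_carrier_mat[OF g] GL_inv[OF g] x
  by (simp add: minus_mult_distrib_mat[of _ n n] mult_minus_distrib_mat[of _ n n _ n])

text \<open>The inner factors \<open>g^-1 g\<close> cancel. This serves to bring \<open>U\<close>
  into triangular form and to show that the filtration is invariant under \<Gamma>.\<close>

lemma diff_prod_conj:
  assumes g: "g \<in> carrier (GL n)" and "set xs \<subseteq> carrier_mat n n"
  shows "diff_prod n (map (\<lambda>x. g * x * inv\<^bsub>GL n\<^esub> g) xs) = g * diff_prod n xs * inv\<^bsub>GL n\<^esub> g"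
  using assms(2)
proof (induction xs)
  case Nil
  then show ?case using GL_carrier_mat[OF g] GL_inv[OF g] by simp
next
  case (Cons x xs)
  note gc = GL_carrier_mat[OF g] and i = GL_inv[OF g]
  define i where "i = inv\<^bsub>GL n\<^esub> g"
  define D where "D = diff_prod n xs"
  have D: "D \<in> carrier_mat n n" using Cons diff_prod_carrier by (simp add: D_def)
  have i: "i \<in> carrier_mat n n" "i * g = 1\<^sub>m n" using i by (simp_all add: i_def)
  define y where "y = x - 1\<^sub>m n"
  have y: "y \<in> carrier_mat n n" using Cons by (simp add: y_def minus_carrier_mat)
  have "g * y * i * (g * D * i) = g * y * (i * g) * D * i"
    using gc i(1) D y by (simp add: assoc_mult_mat[of _ n n _ n _ n])
  also have "\<dots> = g * (y * D) * i"
    using gc i D y by (simp add: assoc_mult_mat[of _ n n _ n _ n])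
  finally show ?case
    using Cons conj_diff_one[OF g, of x] by (simp add: i_def D_def y_def)
qed

text \<open>With \<open>I\<close> the augmentation ideal of \<open>U\<close>, level \<open>j\<close>
  consists of the \<open>u\<close> acting trivially on the image of \<open>I^j\<close>. The levels
  ascend from the trivial group at 0 and reach all of \<open>U\<close> at \<open>n\<close> when
  \<open>U\<close> is unipotent. They are defined from \<open>U\<close> alone, so whatever
  normalises \<open>U\<close> preserves them.\<close>

definition unipotent_filtration :: "nat \<Rightarrow> complex mat set \<Rightarrow> nat \<Rightarrow> complex mat set" where
  "unipotent_filtration n U j =
     {u \<in> U. \<forall>xs. set xs \<subseteq> U \<longrightarrow> length xs = j \<longrightarrow> diff_prod n (u # xs) = 0\<^sub>m n n}"

lemma unipotent_filtrationD:
  "u \<in> unipotent_filtration n U j \<Longrightarrow> u \<in> U"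
  "u \<in> unipotent_filtration n U j \<Longrightarrow> set xs \<subseteq> U \<Longrightarrow> length xs = j \<Longrightarrow>
    (u - 1\<^sub>m n) * diff_prod n xs = 0\<^sub>m n n"
  by (simp_all add: unipotent_filtration_def)

lemma unipotent_filtrationI:
  "u \<in> U \<Longrightarrow> (\<And>xs. set xs \<subseteq> U \<Longrightarrow> length xs = j \<Longrightarrow> (u - 1\<^sub>m n) * diff_prod n xs = 0\<^sub>m n n)
    \<Longrightarrow> u \<in> unipotent_filtration n U j"
  by (simp add: unipotent_filtration_def)

lemma unipotent_filtration_0:
  assumes "u \<in> unipotent_filtration n U 0" "u \<in> carrier_mat n n"
  shows "u = 1\<^sub>m n"
proof -
  have "u - 1\<^sub>m n = 0\<^sub>m n n"
    using unipotent_filtrationD(2)[OF assms(1), of "[]"] assms(2) by (simp add: minus_carrier_mat)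
  then show ?thesis using assms(2) by (auto simp: mat_eq_iff)
qed

text \<open>Each factor \<open>x - 1\<close> is strictly upper triangular, and multiplying by it
  moves the support of a matrix up by one diagonal.\<close>

lemma diff_prod_strictly_upper:
  assumes "set xs \<subseteq> upper_unitriangular n" "i < n" "j < n" "j < i + length xs"
  shows "diff_prod n xs $$ (i, j) = 0"
  using assms
proof (induction xs arbitrary: i)
  case Nil
  then show ?case by simp
next
  case (Cons x xs)
  have xc: "x \<in> carrier_mat n n" and xsc: "set xs \<subseteq> carrier_mat n n"
    using Cons.prems(1) GL_carrier_mat by (auto simp: upper_unitriangular_def)
  have "diff_prod n (x # xs) $$ (i, j) = (\<Sum>k<n. (x - 1\<^sub>m n) $$ (i, k) * diff_prod n xs $$ (k, j))"
    using xc diff_prod_carrier[OF xsc] Cons.prems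
    by (simp add: scalar_prod_def lessThan_atLeast0)
  also have "\<dots> = 0"
  proof (rule sum.neutral, safe)
    fix k assume k: "k < n"
    show "(x - 1\<^sub>m n) $$ (i, k) * diff_prod n xs $$ (k, j) = 0"
    \<comment> \<open>For \<open>k \<le> i\<close> the first factor vanishes. Otherwise the row
      index has grown by at least one, which makes up for the shorter list in the induction
      hypothesis.\<close>
    proof (cases "k \<le> i")
      case True
      then have "(x - 1\<^sub>m n) $$ (i, k) = 0"
        using Cons.prems k xc by (cases "k = i") (auto simp: upper_unitriangular_def)
      then show ?thesis by simp
    next
      case False
      then show ?thesis using Cons k by simp
    qed
  qed
  finally show ?case .
qed

text \<open>After conjugation into unitriangular form the product has \<open>n + 1\<close> strictly
  upper triangular factors of size \<open>n\<close>, so it vanishes; conjugating back gives the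
  claim.\<close>

lemma unipotent_filtration_top:
  assumes U: "unipotent_subgroup n U"
  shows "unipotent_filtration n U n = U"
proof
  show "unipotent_filtration n U n \<subseteq> U" by (auto dest: unipotent_filtrationD)
  obtain P where P: "P \<in> carrier (GL n)"
    and up: "\<And>u. u \<in> U \<Longrightarrow> P * u * inv\<^bsub>GL n\<^esub> P \<in> upper_unitriangular n"
    using U unfolding unipotent_subgroup_def mult_GL by blast
  have Uc: "U \<subseteq> carrier_mat n n"
    using U GL_carrier_mat subgroup.subset[of U "GL n"] by (auto simp: unipotent_subgroup_def)
  note i = GL_inv[OF P] and Pc = GL_carrier_mat[OF P]
  show "U \<subseteq> unipotent_filtration n U n"
  proof (rule subsetI, rule unipotent_filtrationI)
    fix u xs assume u: "u \<in> U" and xs: "set xs \<subseteq> U" "length xs = n"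
    let ?ys = "map (\<lambda>x. P * x * inv\<^bsub>GL n\<^esub> P) (u # xs)"
    define D where "D = diff_prod n (u # xs)"
    have xc: "set (u # xs) \<subseteq> carrier_mat n n" using u xs Uc by auto
    have D: "D \<in> carrier_mat n n" unfolding D_def by (rule diff_prod_carrier[OF xc])
    have "set ?ys \<subseteq> upper_unitriangular n" using up u xs(1) by auto
    then have "diff_prod n ?ys $$ (i, j) = 0" if "i < n" "j < n" for i j
      using that xs(2) by (intro diff_prod_strictly_upper) auto
    then have "P * D * inv\<^bsub>GL n\<^esub> P = 0\<^sub>m n n"
      unfolding diff_prod_conj[OF P xc] D_def[symmetric]
      using D Pc i(1) by (intro eq_matI) (simp_all del: index_mult_mat(1))
    then have "inv\<^bsub>GL n\<^esub> P * (P * D * inv\<^bsub>GL n\<^esub> P) * P = 0\<^sub>m n n"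
      using Pc i(1) by simp
    moreover have "inv\<^bsub>GL n\<^esub> P * (P * D * inv\<^bsub>GL n\<^esub> P) * P = (inv\<^bsub>GL n\<^esub> P * P) * D * (inv\<^bsub>GL n\<^esub> P * P)"
      using Pc i(1) D by (simp add: assoc_mult_mat[of _ n n _ n _ n])
    ultimately have "D = 0\<^sub>m n n" using i D by simp
    then show "(u - 1\<^sub>m n) * diff_prod n xs = 0\<^sub>m n n" by (simp add: D_def)
  qed
qed

section \<open>The layers of the filtration as torsion-free additive groups\<close>

context
  fixes n :: nat and U :: "complex mat set"
  assumes U: "subgroup U (GL n)"
begin

lemma subgroup_carrier_mat: "U \<subseteq> carrier_mat n n"
  using GL_carrier_mat subgroup.subset[OF U] by auto

lemma diff_prod_subgroup_carrier: "set xs \<subseteq> U \<Longrightarrow> diff_prod n xs \<in> carrier_mat n n"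
  using diff_prod_carrier subgroup_carrier_mat by blast

lemma diff_one_inv:
  assumes u: "u \<in> U" and P: "P \<in> carrier_mat n n" and "(u - 1\<^sub>m n) * P = 0\<^sub>m n n"
  shows "(inv\<^bsub>GL n\<^esub> u - 1\<^sub>m n) * P = 0\<^sub>m n n"
proof -
  have uG: "u \<in> carrier (GL n)" using u subgroup.subset[OF U] by blast
  note i = GL_inv[OF uG]
  have "(inv\<^bsub>GL n\<^esub> u * u - 1\<^sub>m n) * P = inv\<^bsub>GL n\<^esub> u * ((u - 1\<^sub>m n) * P) + (inv\<^bsub>GL n\<^esub> u - 1\<^sub>m n) * P"
    by (rule mult_diff_one[OF i(1) GL_carrier_mat[OF uG] P])
  moreover have "(inv\<^bsub>GL n\<^esub> u - 1\<^sub>m n) * P \<in> carrier_mat n n"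
    by (rule diff_one_mult_carrier[OF P])
  ultimately show ?thesis using i P assms(3) by (simp add: one_diff_one_mult)
qed

lemma subgroup_unipotent_filtration: "subgroup (unipotent_filtration n U j) (GL n)"
proof (rule group.subgroupI[OF group_GL])
  show "unipotent_filtration n U j \<subseteq> carrier (GL n)"
    using subgroup.subset[OF U] by (auto dest: unipotent_filtrationD)
  have "\<one>\<^bsub>GL n\<^esub> \<in> unipotent_filtration n U j"
    using subgroup.one_closed[OF U] diff_prod_subgroup_carrier
    by (intro unipotent_filtrationI) (auto simp: one_diff_one_mult)
  then show "unipotent_filtration n U j \<noteq> {}" by blast
  fix a assume a: "a \<in> unipotent_filtration n U j"
  note aU = unipotent_filtrationD(1)[OF a]
  show "inv\<^bsub>GL n\<^esub> a \<in> unipotent_filtration n U j"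
    by (intro unipotent_filtrationI subgroup.m_inv_closed[OF U aU]
        diff_one_inv[OF aU diff_prod_subgroup_carrier] unipotent_filtrationD(2)[OF a])
  fix b assume b: "b \<in> unipotent_filtration n U j"
  note bU = unipotent_filtrationD(1)[OF b]
  show "a \<otimes>\<^bsub>GL n\<^esub> b \<in> unipotent_filtration n U j"
  proof (intro unipotent_filtrationI subgroup.m_closed[OF U aU bU])
    fix xs assume xs: "set xs \<subseteq> U" "length xs = j"
    have c: "a \<in> carrier_mat n n" "b \<in> carrier_mat n n" using aU bU subgroup_carrier_mat by auto
    show "(a \<otimes>\<^bsub>GL n\<^esub> b - 1\<^sub>m n) * diff_prod n xs = 0\<^sub>m n n"
      using mult_diff_one[OF c diff_prod_subgroup_carrier[OF xs(1)]]
        unipotent_filtrationD(2)[OF a xs] unipotent_filtrationD(2)[OF b xs] c by simp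
  qed
qed

text \<open>A test list for the conjugate of \<open>u\<close> is the conjugate of a test list for
  \<open>u\<close>. Invariance of \<open>U\<close> under \<open>g\<close> and under its inverse is
  used, since the list has to be pulled back into \<open>U\<close>.\<close>

lemma unipotent_filtration_conj:
  assumes g: "g \<in> carrier (GL n)"
    and norm: "\<And>x. x \<in> U \<Longrightarrow> g * x * inv\<^bsub>GL n\<^esub> g \<in> U" "\<And>x. x \<in> U \<Longrightarrow> inv\<^bsub>GL n\<^esub> g * x * g \<in> U"
    and u: "u \<in> unipotent_filtration n U j"
  shows "g * u * inv\<^bsub>GL n\<^esub> g \<in> unipotent_filtration n U j"
proof (rule unipotent_filtrationI)
  note uU = unipotent_filtrationD(1)[OF u] and gc = GL_carrier_mat[OF g] and i = GL_inv[OF g]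
  show "g * u * inv\<^bsub>GL n\<^esub> g \<in> U" by (rule norm(1)[OF uU])
  fix xs assume xs: "set xs \<subseteq> U" "length xs = j"
  define ys where "ys = map (\<lambda>x. inv\<^bsub>GL n\<^esub> g * x * g) xs"
  have ys: "set ys \<subseteq> U" "length ys = j" using xs norm(2) by (auto simp: ys_def)
  have cancel: "g * (inv\<^bsub>GL n\<^esub> g * x * g) * inv\<^bsub>GL n\<^esub> g = x" if "x \<in> U" for x
  proof -
    have x: "x \<in> carrier_mat n n" using that subgroup_carrier_mat by blast
    have "g * (inv\<^bsub>GL n\<^esub> g * x * g) * inv\<^bsub>GL n\<^esub> g = (g * inv\<^bsub>GL n\<^esub> g) * x * (g * inv\<^bsub>GL n\<^esub> g)"
      using gc i(1) x by (simp add: assoc_mult_mat[of _ n n _ n _ n])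
    then show ?thesis using i x by simp
  qed
  have "map (\<lambda>x. g * x * inv\<^bsub>GL n\<^esub> g) ys = xs"
    unfolding ys_def map_map using xs(1) cancel by (intro map_idI) auto
  then have "(g * u * inv\<^bsub>GL n\<^esub> g - 1\<^sub>m n) * diff_prod n xs
      = diff_prod n (map (\<lambda>x. g * x * inv\<^bsub>GL n\<^esub> g) (u # ys))" by simp
  also have "\<dots> = g * diff_prod n (u # ys) * inv\<^bsub>GL n\<^esub> g"
    using uU ys subgroup_carrier_mat by (intro diff_prod_conj[OF g]) auto
  also have "diff_prod n (u # ys) = 0\<^sub>m n n" using unipotent_filtrationD(2)[OF u ys] by simp
  finally show "(g * u * inv\<^bsub>GL n\<^esub> g - 1\<^sub>m n) * diff_prod n xs = 0\<^sub>m n n"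
    using gc i(1) by simp
qed

text \<open>The cross term \<open>(u - 1) * (v - 1) * diff_prod n xs\<close> vanishes, whence additivity.\<close>

lemma diff_one_mult_additive:
  assumes u: "u \<in> unipotent_filtration n U (Suc j)" and v: "v \<in> U"
    and xs: "set xs \<subseteq> U" "length xs = j"
  shows "(u * v - 1\<^sub>m n) * diff_prod n xs = (u - 1\<^sub>m n) * diff_prod n xs + (v - 1\<^sub>m n) * diff_prod n xs"
proof -
  note P = diff_prod_subgroup_carrier[OF xs(1)]
  have c: "u \<in> carrier_mat n n" "v \<in> carrier_mat n n"
    using unipotent_filtrationD(1)[OF u] v subgroup_carrier_mat by auto
  define Q where "Q = (v - 1\<^sub>m n) * diff_prod n xs"
  have Q: "Q \<in> carrier_mat n n" using P c by (simp add: Q_def diff_one_mult_carrier)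
  have "(u - 1\<^sub>m n) * diff_prod n (v # xs) = 0\<^sub>m n n"
    by (rule unipotent_filtrationD(2)[OF u]) (use v xs in auto)
  then have "u * Q - Q = 0\<^sub>m n n"
    using c Q by (simp add: Q_def minus_mult_distrib_mat[of _ n n])
  then have "u * Q = Q" using c Q by (auto simp: mat_eq_iff simp del: index_mult_mat(1))
  then have "(u * v - 1\<^sub>m n) * diff_prod n xs = Q + (u - 1\<^sub>m n) * diff_prod n xs"
    using mult_diff_one[OF c P] by (simp add: Q_def)
  also have "\<dots> = (u - 1\<^sub>m n) * diff_prod n xs + Q"
    using Q P c by (intro comm_add_mat[of _ n n]) (auto simp: diff_one_mult_carrier)
  finally show ?thesis by (simp add: Q_def)
qed

lemma diff_one_inv_additive:
  assumes u: "u \<in> unipotent_filtration n U (Suc j)"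
    and xs: "set xs \<subseteq> U" "length xs = j"
  shows "(inv\<^bsub>GL n\<^esub> u - 1\<^sub>m n) * diff_prod n xs = - ((u - 1\<^sub>m n) * diff_prod n xs)"
proof -
  note P = diff_prod_subgroup_carrier[OF xs(1)] and uU = unipotent_filtrationD(1)[OF u]
  have uG: "u \<in> carrier (GL n)" using uU subgroup.subset[OF U] by blast
  note i = GL_inv[OF uG]
  have "(u - 1\<^sub>m n) * diff_prod n xs + (inv\<^bsub>GL n\<^esub> u - 1\<^sub>m n) * diff_prod n xs = 0\<^sub>m n n"
    using diff_one_mult_additive[OF u subgroup.m_inv_closed[OF U uU] xs] i P
    by (simp add: one_diff_one_mult)
  moreover have "(u - 1\<^sub>m n) * diff_prod n xs \<in> carrier_mat n n"
    "(inv\<^bsub>GL n\<^esub> u - 1\<^sub>m n) * diff_prod n xs \<in> carrier_mat n n"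
    by (simp_all add: diff_one_mult_carrier P)
  ultimately show ?thesis
    by (auto simp: mat_eq_iff eq_neg_iff_add_eq_0 add.commute simp del: index_mult_mat(1))
qed

lemma diff_one_pow_additive:
  assumes u: "u \<in> unipotent_filtration n U (Suc j)"
    and xs: "set xs \<subseteq> U" "length xs = j"
  shows "(u [^]\<^bsub>GL n\<^esub> (k::nat) - 1\<^sub>m n) * diff_prod n xs = of_nat k \<cdot>\<^sub>m ((u - 1\<^sub>m n) * diff_prod n xs)"
proof (induction k)
  case 0
  show ?case using diff_prod_subgroup_carrier[OF xs(1)]
    by (auto simp: one_diff_one_mult diff_one_mult_carrier mat_eq_iff simp del: index_mult_mat(1))
next
  case (Suc k)
  note P = diff_prod_subgroup_carrier[OF xs(1)] and uU = unipotent_filtrationD(1)[OF u]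
  have "u [^]\<^bsub>GL n\<^esub> k \<in> unipotent_filtration n U (Suc j)"
    by (rule group.subgroup_nat_pow_closed[OF group_GL subgroup_unipotent_filtration u])
  then have "(u [^]\<^bsub>GL n\<^esub> k * u - 1\<^sub>m n) * diff_prod n xs
     = of_nat k \<cdot>\<^sub>m ((u - 1\<^sub>m n) * diff_prod n xs) + (u - 1\<^sub>m n) * diff_prod n xs"
    using diff_one_mult_additive[OF _ uU xs] Suc by simp
  moreover have "(u - 1\<^sub>m n) * diff_prod n xs \<in> carrier_mat n n"
    by (simp_all add: diff_one_mult_carrier P)
  ultimately show ?case
    using P by (auto simp: mat_eq_iff algebra_simps nat_pow_def simp del: index_mult_mat(1))
qed

text \<open>Modulo level \<open>j\<close>, an element of level \<open>j + 1\<close> is determined by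
  the matrices \<open>d u\<close> over all lists of length \<open>j\<close>. These are additive in
  \<open>u\<close>, so a \<open>q\<close>-th power multiplies them by \<open>q\<close>, which
  cancels over the complex numbers.\<close>

lemma unipotent_filtration_unique_roots:
  assumes u: "u \<in> unipotent_filtration n U (Suc j)" and v: "v \<in> unipotent_filtration n U (Suc j)"
    and q: "q > 0"
    and uv: "u [^]\<^bsub>GL n\<^esub> (q::nat) \<otimes>\<^bsub>GL n\<^esub> inv\<^bsub>GL n\<^esub> (v [^]\<^bsub>GL n\<^esub> q) \<in> unipotent_filtration n U j"
  shows "u \<otimes>\<^bsub>GL n\<^esub> inv\<^bsub>GL n\<^esub> v \<in> unipotent_filtration n U j"
proof (rule unipotent_filtrationI)
  note sF = subgroup_unipotent_filtration
  note pow = group.subgroup_nat_pow_closed[OF group_GL sF]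
  note uU = unipotent_filtrationD(1)[OF u] and vU = unipotent_filtrationD(1)[OF v]
  show "u \<otimes>\<^bsub>GL n\<^esub> inv\<^bsub>GL n\<^esub> v \<in> U"
    by (intro subgroup.m_closed[OF U] subgroup.m_inv_closed[OF U] uU vU)
  fix xs assume xs: "set xs \<subseteq> U" "length xs = j"
  define d where "d w = (w - 1\<^sub>m n) * diff_prod n xs" for w
  have dc: "d w \<in> carrier_mat n n" for w
    using diff_prod_subgroup_carrier[OF xs(1)] by (simp add: d_def diff_one_mult_carrier)
  have d: "d (x \<otimes>\<^bsub>GL n\<^esub> inv\<^bsub>GL n\<^esub> y) = d x + - d y"
    if "x \<in> unipotent_filtration n U (Suc j)" "y \<in> unipotent_filtration n U (Suc j)" for x y
    using diff_one_mult_additive[OF that(1) subgroup.m_inv_closed[OF U unipotent_filtrationD(1)[OF that(2)]] xs]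
      diff_one_inv_additive[OF that(2) xs] by (simp add: d_def)
  have "d (u [^]\<^bsub>GL n\<^esub> q) + - d (v [^]\<^bsub>GL n\<^esub> q) = 0\<^sub>m n n"
    using d[OF pow[OF u] pow[OF v]] unipotent_filtrationD(2)[OF uv xs] by (simp add: d_def)
  moreover have "d (u [^]\<^bsub>GL n\<^esub> q) = of_nat q \<cdot>\<^sub>m d u" "d (v [^]\<^bsub>GL n\<^esub> q) = of_nat q \<cdot>\<^sub>m d v"
    unfolding d_def by (rule diff_one_pow_additive[OF u xs], rule diff_one_pow_additive[OF v xs])
  ultimately have "of_nat q \<cdot>\<^sub>m d u + - (of_nat q \<cdot>\<^sub>m d v) = 0\<^sub>m n n" by simp
  then have "d u + - d v = 0\<^sub>m n n"
    using dc[of u] dc[of v] q by (auto simp: mat_eq_iff)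
  then show "(u \<otimes>\<^bsub>GL n\<^esub> inv\<^bsub>GL n\<^esub> v - 1\<^sub>m n) * diff_prod n xs = 0\<^sub>m n n"
    using d[OF u v] by (simp add: d_def)
qed

end

section \<open>Divisibility and torsion\<close>

text \<open>The integer vectors supported on the finite set \<open>S\<close> form a finitely
  generated group, whose torsion modulo \<open>B\<close> has bounded exponent; \<open>t\<close> is
  such a bound. The induction on \<open>S\<close> eliminates one coordinate at a time.\<close>

lemma subgroup_multiple_saturation:
  fixes B :: "('i \<Rightarrow> int) set"
  assumes S: "finite S" and B0: "(\<lambda>_. 0) \<in> B"
    and Bm: "\<And>x y. x \<in> B \<Longrightarrow> y \<in> B \<Longrightarrow> (\<lambda>i. x i - y i) \<in> B"
  shows "\<exists>t>0. \<forall>z m. (\<forall>i. i \<notin> S \<longrightarrow> z i = 0) \<longrightarrow> m > 0 \<longrightarrow> (\<lambda>i. m * z i) \<in> B \<longrightarrow> (\<lambda>i. t * z i) \<in> B"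
proof -
  have Bn: "(\<lambda>i. - x i) \<in> B" if "x \<in> B" for x
    using Bm[OF B0 that] by simp
  have Bp: "(\<lambda>i. x i + y i) \<in> B" if "x \<in> B" "y \<in> B" for x y
    using Bm[OF that(1) Bn[OF that(2)]] by simp
  have Bk: "(\<lambda>i. k * x i) \<in> B" if x: "x \<in> B" for k x
  proof -
    have nat: "(\<lambda>i. int j * x i) \<in> B" for j
    proof (induction j)
      case (Suc j)
      show ?case using Bp[OF Suc x] by (simp add: algebra_simps)
    qed (simp add: B0)
    show ?thesis
    proof (cases "k \<ge> 0")
      case True
      then show ?thesis using nat[of "nat k"] by simp
    next
      case False
      then show ?thesis using Bn[OF nat[of "nat (- k)"]] by simp
    qed
  qed
  show ?thesis
    using S
  proof (induction S rule: finite_induct)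
    case empty
    show ?case
    proof (intro exI[of _ 1] conjI allI impI)
      fix z :: "'i \<Rightarrow> int" and m :: int
      assume "\<forall>i. i \<notin> {} \<longrightarrow> z i = 0"
      then have "z = (\<lambda>_. 0)" by auto
      then show "(\<lambda>i. 1 * z i) \<in> B" using B0 by simp
    qed simp
  next
    case (insert a S)
    then obtain t where t: "t > 0"
      "\<And>z m. (\<forall>i. i \<notin> S \<longrightarrow> z i = 0) \<Longrightarrow> m > 0 \<Longrightarrow> (\<lambda>i. m * z i) \<in> B \<Longrightarrow> (\<lambda>i. t * z i) \<in> B"
      by blast
    \<comment> \<open>The saturation of \<open>B\<close>: the vectors supported on
      \<open>insert a S\<close> with a positive multiple in \<open>B\<close>.\<close>
    define Z where "Z = {z. (\<forall>i. i \<notin> insert a S \<longrightarrow> z i = 0) \<and> (\<exists>m>0. (\<lambda>i. m * z i) \<in> B)}"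
    have Zmk: "(\<lambda>i. x i - k * y i) \<in> Z" if xy: "x \<in> Z" "y \<in> Z" for x y k
    proof -
      obtain m l where ml: "m > 0" "(\<lambda>i. m * x i) \<in> B" "l > 0" "(\<lambda>i. l * y i) \<in> B"
        using xy unfolding Z_def by auto
      have "(\<lambda>i. l * (m * x i) - (m * k) * (l * y i)) \<in> B"
        by (rule Bm[OF Bk[OF ml(2)] Bk[OF ml(4)]])
      then have "(\<lambda>i. (m * l) * (x i - k * y i)) \<in> B" by (simp add: algebra_simps)
      moreover have "m * l > 0" using ml by simp
      ultimately show ?thesis using xy unfolding Z_def by auto
    qed
    show ?case
    proof (cases "\<exists>z\<in>Z. z a \<noteq> 0")
      case False
      have "(\<lambda>i. t * z i) \<in> B"
        if z: "\<forall>i. i \<notin> insert a S \<longrightarrow> z i = 0" and m: "m > 0" "(\<lambda>i. m * z i) \<in> B" for z m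
      proof -
        have "z a = 0" using False that unfolding Z_def by blast
        then have "\<forall>i. i \<notin> S \<longrightarrow> z i = 0" using z by auto
        then show ?thesis using t m by blast
      qed
      then show ?thesis using t(1) by blast
    next
      case True
      \<comment> \<open>Division by a least nonzero value at \<open>a\<close> leaves remainder 0, so
        every vector of \<open>Z\<close> becomes supported on \<open>S\<close> after subtracting a
        multiple of \<open>y\<close>.\<close>
      then obtain y where y: "y \<in> Z" "y a \<noteq> 0"
        and ymin: "\<And>z. z \<in> Z \<Longrightarrow> z a \<noteq> 0 \<Longrightarrow> nat \<bar>y a\<bar> \<le> nat \<bar>z a\<bar>"
        using ex_has_least_nat[of "\<lambda>z. z \<in> Z \<and> z a \<noteq> 0" _ "\<lambda>z. nat \<bar>z a\<bar>"] by blast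
      obtain l where l: "l > 0" "(\<lambda>i. l * y i) \<in> B" using y(1) unfolding Z_def by auto
      \<comment> \<open>The factor \<open>t\<close> takes the part \<open>w\<close> supported on
        \<open>S\<close> into \<open>B\<close>, and \<open>l\<close> takes \<open>y\<close> into
        \<open>B\<close>; their product handles \<open>z = w + k y\<close>.\<close>
      have "(\<lambda>i. (l * t) * z i) \<in> B"
        if z: "\<forall>i. i \<notin> insert a S \<longrightarrow> z i = 0" and m: "m > 0" "(\<lambda>i. m * z i) \<in> B" for z m
      proof -
        define k where "k = z a div y a"
        define w where "w = (\<lambda>i. z i - k * y i)"
        have w: "w \<in> Z" unfolding w_def by (rule Zmk[OF _ y(1)]) (use that in \<open>auto simp: Z_def\<close>)
        have "w a = z a mod y a" by (simp add: w_def k_def minus_div_mult_eq_mod)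
        then have "\<bar>w a\<bar> < \<bar>y a\<bar>" using y(2) by (simp add: abs_mod_less)
        then have wa: "w a = 0" using ymin[OF w] by linarith
        obtain m' where m': "m' > 0" "(\<lambda>i. m' * w i) \<in> B" using w unfolding Z_def by auto
        have "\<forall>i. i \<notin> S \<longrightarrow> w i = 0" using w wa unfolding Z_def by auto
        then have "(\<lambda>i. t * w i) \<in> B" using t(2) m' by blast
        then have "(\<lambda>i. l * (t * w i) + (k * t) * (l * y i)) \<in> B"
          using Bp Bk[OF l(2), of "k * t"] Bk[of "\<lambda>i. t * w i" l] by auto
        then show ?thesis by (simp add: w_def algebra_simps)
      qed
      moreover have "l * t > 0" using l t by simp
      ultimately show ?thesis by blast
    qed
  qed
qed

text \<open>If \<open>u = 1 + q t Z\<close> with \<open>Z\<close> integral, then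
  \<open>q t Z\<close> represents the image of \<open>u\<close> in the layer. For a saturation
  exponent \<open>t\<close> of the representable integer matrices, \<open>t Z\<close> is itself
  represented by some \<open>b\<close>, and \<open>b^q\<close> agrees with \<open>u\<close> modulo
  level \<open>j\<close>.\<close>

lemma unipotent_filtration_divisible:
  fixes q :: nat
  assumes L: "arithmetic_lattice n \<Lambda>" and U: "subgroup U (GL n)" and q: "q > 0"
  obtains N where "normal_finite_index (GL n) \<Lambda> N"
    "\<And>u. u \<in> unipotent_filtration n U (Suc j) \<Longrightarrow> u \<in> N \<Longrightarrow>
      \<exists>b\<in>unipotent_filtration n U (Suc j).
        inv\<^bsub>GL n\<^esub> (b [^]\<^bsub>GL n\<^esub> q) \<otimes>\<^bsub>GL n\<^esub> u \<in> unipotent_filtration n U j"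
proof -
  let ?F = "unipotent_filtration n U"
  interpret G: group "GL n" by (rule group_GL)
  note sF = subgroup_unipotent_filtration[OF U]
  define T where "T xs \<longleftrightarrow> set xs \<subseteq> U \<and> length xs = j" for xs
  define zmat where "zmat z = mat n n (\<lambda>ij. complex_of_int (z ij))" for z
  define d where "d u xs = (u - 1\<^sub>m n) * diff_prod n xs" for u xs
  have P: "diff_prod n xs \<in> carrier_mat n n" if "T xs" for xs
    using diff_prod_subgroup_carrier[OF U] that by (simp add: T_def)
  have dc: "d u xs \<in> carrier_mat n n" if "T xs" for u xs
    unfolding d_def by (rule diff_one_mult_carrier[OF P[OF that]])
  have d_mult: "d (u * v) xs = d u xs + d v xs" if "u \<in> ?F (Suc j)" "v \<in> ?F (Suc j)" "T xs" for u v xs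
    unfolding d_def using diff_one_mult_additive[OF U that(1) unipotent_filtrationD(1)[OF that(2)]] that(3)
    by (simp add: T_def)
  have d_inv: "d (inv\<^bsub>GL n\<^esub> u) xs = - d u xs" if "u \<in> ?F (Suc j)" "T xs" for u xs
    unfolding d_def using diff_one_inv_additive[OF U that(1)] that(2) by (simp add: T_def)
  have d_pow: "d (u [^]\<^bsub>GL n\<^esub> q) xs = of_nat q \<cdot>\<^sub>m d u xs" if "u \<in> ?F (Suc j)" "T xs" for u xs
    unfolding d_def using diff_one_pow_additive[OF U that(1)] that(2) by (simp add: T_def)
  have zc: "zmat z \<in> carrier_mat n n" for z by (simp add: zmat_def)
  have z_diff: "zmat (\<lambda>i. x i - y i) = zmat x - zmat y" for x y
    by (intro eq_matI) (simp_all add: zmat_def)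
  have z_mult: "zmat (\<lambda>i. k * x i) = of_int k \<cdot>\<^sub>m zmat x" for k x
    by (intro eq_matI) (simp_all add: zmat_def)
  \<comment> \<open>The integer matrices acting on all test products like \<open>u - 1\<close> for
    some \<open>u\<close> of level \<open>j + 1\<close>. By additivity they form a group, although
    \<open>u - 1\<close> itself need not be integral.\<close>
  define B where "B = {z. \<exists>u\<in>?F (Suc j). \<forall>xs. T xs \<longrightarrow> d u xs = zmat z * diff_prod n xs}"
  have B0: "(\<lambda>_. 0) \<in> B"
  proof -
    have "zmat (\<lambda>_. 0) = 0\<^sub>m n n" by (intro eq_matI) (simp_all add: zmat_def)
    then have "d (1\<^sub>m n) xs = zmat (\<lambda>_. 0) * diff_prod n xs" if "T xs" for xs
      using P[OF that] by (simp add: d_def one_diff_one_mult)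
    then show ?thesis using subgroup.one_closed[OF sF] by (auto simp: B_def)
  qed
  have Bm: "(\<lambda>i. x i - y i) \<in> B" if xy: "x \<in> B" "y \<in> B" for x y
  proof -
    obtain u where u: "u \<in> ?F (Suc j)" "\<And>xs. T xs \<Longrightarrow> d u xs = zmat x * diff_prod n xs"
      using xy(1) by (auto simp: B_def)
    obtain v where v: "v \<in> ?F (Suc j)" "\<And>xs. T xs \<Longrightarrow> d v xs = zmat y * diff_prod n xs"
      using xy(2) by (auto simp: B_def)
    have iv: "inv\<^bsub>GL n\<^esub> v \<in> ?F (Suc j)" by (rule subgroup.m_inv_closed[OF sF v(1)])
    have "d (u * inv\<^bsub>GL n\<^esub> v) xs = zmat (\<lambda>i. x i - y i) * diff_prod n xs" if xs: "T xs" for xs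
    proof -
      have "d (u * inv\<^bsub>GL n\<^esub> v) xs = d u xs + - d v xs"
        by (simp add: d_mult[OF u(1) iv xs] d_inv[OF v(1) xs])
      also have "\<dots> = d u xs - d v xs"
        by (rule add_uminus_minus_mat[OF dc[OF xs] dc[OF xs]])
      also have "\<dots> = zmat (\<lambda>i. x i - y i) * diff_prod n xs"
        unfolding u(2)[OF xs] v(2)[OF xs] z_diff
        by (rule minus_mult_distrib_mat[OF zc zc P[OF xs], symmetric])
      finally show ?thesis .
    qed
    moreover have "u * inv\<^bsub>GL n\<^esub> v \<in> ?F (Suc j)"
      using subgroup.m_closed[OF sF u(1) iv] by simp
    ultimately show ?thesis by (auto simp: B_def)
  qed
  let ?S = "{..<n} \<times> {..<n}"
  have "\<exists>t>0. \<forall>z m. (\<forall>i. i \<notin> ?S \<longrightarrow> z i = 0) \<longrightarrow> m > 0 \<longrightarrow> (\<lambda>i. m * z i) \<in> B \<longrightarrow> (\<lambda>i. t * z i) \<in> B"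
    by (rule subgroup_multiple_saturation[OF _ B0]) (simp, rule Bm)
  then obtain t where t: "t > 0"
    "\<forall>z m. (\<forall>i. i \<notin> ?S \<longrightarrow> z i = 0) \<longrightarrow> m > 0 \<longrightarrow> (\<lambda>i. m * z i) \<in> B \<longrightarrow> (\<lambda>i. t * z i) \<in> B"
    by (elim exE conjE)
  \<comment> \<open>The factor \<open>t\<close> absorbs the torsion modulo \<open>B\<close>, and the
    factor \<open>q\<close> is left over for the \<open>q\<close>-th root.\<close>
  define M where "M = int q * t"
  have M: "M > 0" using q t(1) by (simp add: M_def)
  obtain N where N: "normal_finite_index (GL n) \<Lambda> N" "N \<subseteq> congruence_subgroup n M"
    using arithmetic_lattice_congruence[OF L M] .
  have "\<exists>b\<in>?F (Suc j). inv\<^bsub>GL n\<^esub> (b [^]\<^bsub>GL n\<^esub> q) \<otimes>\<^bsub>GL n\<^esub> u \<in> ?F j"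
    if u: "u \<in> ?F (Suc j)" "u \<in> N" for u
  proof -
    obtain Z where Z: "Z \<in> int_mat n" "u = 1\<^sub>m n + of_int M \<cdot>\<^sub>m Z"
      using u(2) N(2) by (auto simp: congruence_subgroup_def)
    \<comment> \<open>The entries of \<open>Z\<close> as integers, with value 0 outside the index
      square to meet the support condition on \<open>t\<close>.\<close>
    define z where "z ij = (if ij \<in> ?S then \<lfloor>Re (Z $$ ij)\<rfloor> else 0)" for ij
    have Zz: "Z = zmat z"
    proof (rule eq_matI)
      fix i k assume "i < dim_row (zmat z)" "k < dim_col (zmat z)"
      then have ik: "i < n" "k < n" by (simp_all add: zmat_def)
      obtain l where "Z $$ (i, k) = of_int l"
        using int_mat_entry[OF Z(1) ik] by (rule Ints_cases)
      then show "Z $$ (i, k) = zmat z $$ (i, k)" using ik by (simp add: zmat_def z_def)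
    qed (use int_mat_carrier[OF Z(1)] in \<open>auto simp: zmat_def\<close>)
    have du: "d u xs = zmat (\<lambda>i. M * z i) * diff_prod n xs" for xs
    proof -
      have "u - 1\<^sub>m n = of_int M \<cdot>\<^sub>m zmat z"
        unfolding Z(2) Zz using zc[of z] by (intro eq_matI) auto
      then show ?thesis by (simp add: d_def z_mult)
    qed
    then have "(\<lambda>i. M * z i) \<in> B" using u(1) by (auto simp: B_def)
    then have "(\<lambda>i. t * z i) \<in> B" using t(2)[THEN spec, THEN spec, of z M] M by (simp add: z_def)
    then obtain b where b: "b \<in> ?F (Suc j)"
      "\<And>xs. T xs \<Longrightarrow> d b xs = zmat (\<lambda>i. t * z i) * diff_prod n xs"
      by (auto simp: B_def)
    have bq: "b [^]\<^bsub>GL n\<^esub> q \<in> ?F (Suc j)" by (rule G.subgroup_nat_pow_closed[OF sF b(1)])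
    have ibq: "inv\<^bsub>GL n\<^esub> (b [^]\<^bsub>GL n\<^esub> q) \<in> ?F (Suc j)" by (rule subgroup.m_inv_closed[OF sF bq])
    have "inv\<^bsub>GL n\<^esub> (b [^]\<^bsub>GL n\<^esub> q) \<otimes>\<^bsub>GL n\<^esub> u \<in> ?F j"
    proof (rule unipotent_filtrationI)
      show "inv\<^bsub>GL n\<^esub> (b [^]\<^bsub>GL n\<^esub> q) \<otimes>\<^bsub>GL n\<^esub> u \<in> U"
        by (intro subgroup.m_closed[OF U] unipotent_filtrationD(1)[OF ibq] unipotent_filtrationD(1)[OF u(1)])
      fix xs assume "set xs \<subseteq> U" "length xs = j"
      then have xs: "T xs" by (simp add: T_def)
      have "d (b [^]\<^bsub>GL n\<^esub> q) xs = of_nat q \<cdot>\<^sub>m (zmat (\<lambda>i. t * z i) * diff_prod n xs)"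
        by (simp add: d_pow[OF b(1) xs] b(2)[OF xs])
      also have "\<dots> = (of_int (int q) \<cdot>\<^sub>m zmat (\<lambda>i. t * z i)) * diff_prod n xs"
        using mult_smult_assoc_mat[OF zc P[OF xs], symmetric] by simp
      also have "\<dots> = d u xs" unfolding du z_mult[symmetric] by (simp add: M_def mult.assoc)
      finally have "d (inv\<^bsub>GL n\<^esub> (b [^]\<^bsub>GL n\<^esub> q) * u) xs = - d u xs + d u xs"
        by (simp add: d_mult[OF ibq u(1) xs] d_inv[OF bq xs])
      also have "\<dots> = 0\<^sub>m n n" using dc[OF xs] by (rule uminus_l_inv_mat)
      finally show "(inv\<^bsub>GL n\<^esub> (b [^]\<^bsub>GL n\<^esub> q) \<otimes>\<^bsub>GL n\<^esub> u - 1\<^sub>m n) * diff_prod n xs = 0\<^sub>m n n"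
        by (simp add: d_def)
    qed
    then show ?thesis using b(1) by blast
  qed
  then show thesis using that N(1) by blast
qed

text \<open>Induction up the filtration. At level 0 the power \<open>g^m\<close> is already 1. At
  level \<open>j + 1\<close> its closeness to 1 yields a root modulo level \<open>j\<close>;
  correcting \<open>g\<close> by a power of that root brings \<open>g^m\<close> down to level
  \<open>j\<close>, still inside the \<open>N\<close> of the induction hypothesis.\<close>

lemma correct_torsion_unipotent:
  fixes m :: nat
  assumes L: "arithmetic_lattice n \<Lambda>"
    and \<Gamma>: "subgroup \<Gamma> (GL n)" "\<Gamma> \<subseteq> \<Lambda>"
    and U: "subgroup U (GL n)" "U \<subseteq> \<Gamma>"
    and norm: "\<And>g u. g \<in> \<Gamma> \<Longrightarrow> u \<in> U \<Longrightarrow> g * u * inv\<^bsub>GL n\<^esub> g \<in> U"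
    and m: "m > 0"
  shows "\<exists>N. normal_finite_index (GL n) \<Lambda> N \<and>
    (\<forall>g\<in>\<Gamma>. g [^]\<^bsub>GL n\<^esub> m \<in> unipotent_filtration n U j \<inter> N \<longrightarrow>
      (\<exists>u\<in>U. (g \<otimes>\<^bsub>GL n\<^esub> u) [^]\<^bsub>GL n\<^esub> m = 1\<^sub>m n))"
proof (induction j)
  interpret G: group "GL n" by (rule group_GL)
  case 0
  have "\<exists>u\<in>U. (g \<otimes>\<^bsub>GL n\<^esub> u) [^]\<^bsub>GL n\<^esub> m = 1\<^sub>m n"
    if "g \<in> \<Gamma>" "g [^]\<^bsub>GL n\<^esub> m \<in> unipotent_filtration n U 0" for g
  proof (rule bexI)
    have gG: "g \<in> carrier (GL n)" using that(1) subgroup.subset[OF \<Gamma>(1)] by blast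
    have "g [^]\<^bsub>GL n\<^esub> m = 1\<^sub>m n"
      using that(2) GL_carrier_mat[OF G.nat_pow_closed[OF gG]] by (rule unipotent_filtration_0)
    then show "(g \<otimes>\<^bsub>GL n\<^esub> \<one>\<^bsub>GL n\<^esub>) [^]\<^bsub>GL n\<^esub> m = 1\<^sub>m n"
      using G.r_one[OF gG] by simp
    show "\<one>\<^bsub>GL n\<^esub> \<in> U" by (rule subgroup.one_closed[OF U(1)])
  qed
  then show ?case
    using G.normal_finite_index_self[OF arithmetic_lattice_subgroup[OF L]] by blast
next
  interpret G: group "GL n" by (rule group_GL)
  \<comment> \<open>\<Gamma> becomes the ambient group \<open>?H\<close>, since the levels and
    \<open>\<Gamma> \<inter> N\<close> are normal there.\<close>
  let ?F = "unipotent_filtration n U" and ?H = "GL n\<lparr>carrier := \<Gamma>\<rparr>"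
  interpret H: group ?H by (rule G.subgroup_imp_group[OF \<Gamma>(1)])
  note sL = arithmetic_lattice_subgroup[OF L] and sF = subgroup_unipotent_filtration[OF U(1)]
  have \<Gamma>G: "\<Gamma> \<subseteq> carrier (GL n)" by (rule subgroup.subset[OF \<Gamma>(1)])
  have FU: "?F i \<subseteq> U" for i by (auto dest: unipotent_filtrationD)
  have norm': "inv\<^bsub>GL n\<^esub> g * u * g \<in> U" if "g \<in> \<Gamma>" "u \<in> U" for g u
  proof -
    have "g \<in> carrier (GL n)" using that(1) \<Gamma>G by blast
    then show ?thesis using norm[OF subgroup.m_inv_closed[OF \<Gamma>(1) that(1)] that(2)] by simp
  qed
  have nF: "?F i \<lhd> ?H" for i
  proof (rule G.normal_in_subgroupI[OF \<Gamma>(1) sF])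
    show "?F i \<subseteq> \<Gamma>" using FU U(2) by blast
    fix g x assume g: "g \<in> \<Gamma>" and x: "x \<in> ?F i"
    have gG: "g \<in> carrier (GL n)" using g \<Gamma>G by blast
    show "g \<otimes>\<^bsub>GL n\<^esub> x \<otimes>\<^bsub>GL n\<^esub> inv\<^bsub>GL n\<^esub> g \<in> ?F i"
      unfolding mult_GL
      by (rule unipotent_filtration_conj[OF U(1) gG norm[OF g] norm'[OF g] x])
  qed
  case (Suc j)
  then obtain N where N: "normal_finite_index (GL n) \<Lambda> N"
    and IH: "\<And>g. g \<in> \<Gamma> \<Longrightarrow> g [^]\<^bsub>GL n\<^esub> m \<in> ?F j \<inter> N \<Longrightarrow>
      \<exists>u\<in>U. (g \<otimes>\<^bsub>GL n\<^esub> u) [^]\<^bsub>GL n\<^esub> m = 1\<^sub>m n"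
    by blast
  note fi = G.normal_finite_indexD[OF sL N]
  have "\<Gamma> \<inter> N \<lhd> ?H"
  proof (rule G.normal_in_subgroupI[OF \<Gamma>(1) G.subgroups_Inter_pair[OF \<Gamma>(1) fi(2)]])
    fix g x assume g: "g \<in> \<Gamma>" and x: "x \<in> \<Gamma> \<inter> N"
    have "g \<otimes>\<^bsub>GL n\<^esub> x \<otimes>\<^bsub>GL n\<^esub> inv\<^bsub>GL n\<^esub> g \<in> N"
      using fi(4)[of g x] g x \<Gamma>(2) by auto
    moreover have "g \<otimes>\<^bsub>GL n\<^esub> x \<otimes>\<^bsub>GL n\<^esub> inv\<^bsub>GL n\<^esub> g \<in> \<Gamma>"
      using g x by (intro subgroup.m_closed[OF \<Gamma>(1)] subgroup.m_inv_closed[OF \<Gamma>(1)]) auto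
    ultimately show "g \<otimes>\<^bsub>GL n\<^esub> x \<otimes>\<^bsub>GL n\<^esub> inv\<^bsub>GL n\<^esub> g \<in> \<Gamma> \<inter> N" by blast
  qed simp
  note step = H.correct_torsion_step[OF nF nF this, folded G.nat_pow_consistent]
  \<comment> \<open>The order of choices matters: \<open>N\<close> comes from the induction
    hypothesis, \<open>e\<close> depends on \<open>N\<close>, and \<open>N'\<close> has to provide
    roots of order \<open>m * e\<close>.\<close>
  obtain e :: nat where e: "e > 0" "\<And>x. x \<in> \<Lambda> \<Longrightarrow> x [^]\<^bsub>GL n\<^esub> e \<in> N"
    using G.finite_index_exponent[OF sL fi(1)] by blast
  have me: "m * e > 0" using m e(1) by simp
  obtain N' where N': "normal_finite_index (GL n) \<Lambda> N'"
    and div: "\<And>u. u \<in> ?F (Suc j) \<Longrightarrow> u \<in> N' \<Longrightarrow>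
      \<exists>b\<in>?F (Suc j). inv\<^bsub>GL n\<^esub> (b [^]\<^bsub>GL n\<^esub> (m * e)) \<otimes>\<^bsub>GL n\<^esub> u \<in> ?F j"
    using unipotent_filtration_divisible[OF L U(1) me] by blast
  have "\<exists>u\<in>U. (g \<otimes>\<^bsub>GL n\<^esub> u) [^]\<^bsub>GL n\<^esub> m = 1\<^sub>m n"
    if g: "g \<in> \<Gamma>" and gm: "g [^]\<^bsub>GL n\<^esub> m \<in> ?F (Suc j) \<inter> (N \<inter> N')" for g
  proof -
    obtain b where b: "b \<in> ?F (Suc j)"
      "inv\<^bsub>GL n\<^esub> (b [^]\<^bsub>GL n\<^esub> (m * e)) \<otimes>\<^bsub>GL n\<^esub> g [^]\<^bsub>GL n\<^esub> m \<in> ?F j"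
      using div gm by blast
    have pow\<Gamma>: "x [^]\<^bsub>GL n\<^esub> k \<in> \<Gamma>" if "x \<in> ?F (Suc j)" for x and k :: nat
      using that FU U(2) by (intro G.subgroup_nat_pow_closed[OF \<Gamma>(1)]) blast
    have inv_eq: "inv\<^bsub>?H\<^esub> x = inv\<^bsub>GL n\<^esub> x" if "x \<in> \<Gamma>" for x
      by (rule G.m_inv_consistent[OF \<Gamma>(1) that])
    \<comment> \<open>The correction at this level; the induction hypothesis for \<open>g c\<close>
      supplies a further \<open>u\<close>, and \<open>c u\<close> is the total correction.\<close>
    define c where "c = inv\<^bsub>GL n\<^esub> (b [^]\<^bsub>GL n\<^esub> e)"
    have cU: "c \<in> U"
      unfolding c_def using b(1) FU
      by (intro subgroup.m_inv_closed[OF U(1)] G.subgroup_nat_pow_closed[OF U(1)]) blast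
    have "(g \<otimes>\<^bsub>?H\<^esub> inv\<^bsub>?H\<^esub> (b [^]\<^bsub>GL n\<^esub> e)) [^]\<^bsub>GL n\<^esub> m \<in> ?F j \<inter> (\<Gamma> \<inter> N)"
    proof (rule step)
      show "x [^]\<^bsub>GL n\<^esub> e \<in> \<Gamma> \<inter> N" if "x \<in> ?F (Suc j)" for x
        using pow\<Gamma>[OF that] e(2)[of x] that FU U(2) \<Gamma>(2) by blast
      show "x \<otimes>\<^bsub>?H\<^esub> inv\<^bsub>?H\<^esub> y \<in> ?F j"
        if "x \<in> ?F (Suc j)" "y \<in> ?F (Suc j)"
          "x [^]\<^bsub>GL n\<^esub> (m * e) \<otimes>\<^bsub>?H\<^esub> inv\<^bsub>?H\<^esub> (y [^]\<^bsub>GL n\<^esub> (m * e)) \<in> ?F j" for x y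
      proof -
        have "y \<in> \<Gamma>" using that(2) FU U(2) by blast
        then show ?thesis
          using unipotent_filtration_unique_roots[OF U(1) that(1,2) me] that(3) pow\<Gamma>[OF that(2)]
          by (simp add: inv_eq del: mult_GL)
      qed
      show "g \<in> carrier ?H" "b \<in> ?F (Suc j)" using g b by simp_all
      show "g [^]\<^bsub>GL n\<^esub> m \<in> \<Gamma> \<inter> N"
        using gm G.subgroup_nat_pow_closed[OF \<Gamma>(1) g] by blast
      show "inv\<^bsub>?H\<^esub> (b [^]\<^bsub>GL n\<^esub> (m * e)) \<otimes>\<^bsub>?H\<^esub> g [^]\<^bsub>GL n\<^esub> m \<in> ?F j"
        using b(2) pow\<Gamma>[OF b(1)] by (simp add: inv_eq del: mult_GL)
    qed
    then have gc: "(g \<otimes>\<^bsub>GL n\<^esub> c) [^]\<^bsub>GL n\<^esub> m \<in> ?F j \<inter> N"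
      using pow\<Gamma>[OF b(1)] by (simp add: inv_eq c_def del: mult_GL)
    have "g \<otimes>\<^bsub>GL n\<^esub> c \<in> \<Gamma>" using g cU U(2) by (intro subgroup.m_closed[OF \<Gamma>(1)]) auto
    then obtain u where u: "u \<in> U" "(g \<otimes>\<^bsub>GL n\<^esub> c \<otimes>\<^bsub>GL n\<^esub> u) [^]\<^bsub>GL n\<^esub> m = 1\<^sub>m n"
      using IH gc by blast
    have carr: "g \<in> carrier (GL n)" "c \<in> carrier (GL n)" "u \<in> carrier (GL n)"
      using g \<Gamma>G cU u(1) U(2) by auto
    have "(g \<otimes>\<^bsub>GL n\<^esub> (c \<otimes>\<^bsub>GL n\<^esub> u)) [^]\<^bsub>GL n\<^esub> m = 1\<^sub>m n"
      using u(2) G.m_assoc[OF carr] by simp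
    moreover have "c \<otimes>\<^bsub>GL n\<^esub> u \<in> U" by (rule subgroup.m_closed[OF U(1) cU u(1)])
    ultimately show ?thesis by blast
  qed
  then show ?case using G.normal_finite_index_Int[OF sL N N'] by blast
qed

section \<open>Separating the conjugacy class of \<eta> from \<open>\<Gamma> N\<close>\<close>

theorem theorem5p2:
  fixes n :: nat and \<Lambda> \<Gamma> :: "complex mat set" and \<eta> :: "complex mat"
  assumes "arithmetic_lattice n \<Lambda>"
    and "subgroup \<Gamma> (GL n\<lparr>carrier := \<Lambda>\<rparr>)"
    and "torsion_free (GL n) \<Gamma>"
    and "virtually_unipotent n \<Gamma>"
    and "\<eta> \<in> \<Lambda>"
    and "\<eta> \<noteq> \<one>\<^bsub>GL n\<^esub>"
    and "semisimple_mat \<eta>"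
  shows "\<exists>\<Lambda>\<^sub>0. finite_index_subgroup (GL n) \<Lambda> \<Lambda>\<^sub>0 \<and>
              subgroup \<Gamma> (GL n\<lparr>carrier := \<Lambda>\<^sub>0\<rparr>) \<and>
              conjugacy_class (GL n) \<Lambda> \<eta> \<inter> \<Lambda>\<^sub>0 = {}"
proof -
  interpret G: group "GL n" by (rule group_GL)
  note L = assms(1)
  note sL = arithmetic_lattice_subgroup[OF L]
  have LG: "\<Lambda> \<subseteq> carrier (GL n)" by (rule subgroup.subset[OF sL])
  have \<Gamma>: "subgroup \<Gamma> (GL n)" by (rule G.incl_subgroup[OF sL assms(2)])
  have \<Gamma>L: "\<Gamma> \<subseteq> \<Lambda>" using subgroup.subset[OF assms(2)] by simp
  have \<eta>G: "\<eta> \<in> carrier (GL n)" using assms(5) LG by blast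

  obtain U0 where U0: "finite_index_subgroup (GL n) \<Gamma> U0" "unipotent_subgroup n U0"
    using assms(4) by (auto simp: virtually_unipotent_def)
  \<comment> \<open>Level 1 imposes no congruence and only forces integrality, which
    \<open>U\<close> inherits through the intersection.\<close>
  obtain N1 where N1: "normal_finite_index (GL n) \<Lambda> N1" "N1 \<subseteq> congruence_subgroup n 1"
    using arithmetic_lattice_congruence[OF L, of 1] by auto
  have "finite_index_subgroup (GL n) \<Gamma> (\<Gamma> \<inter> N1)"
    by (rule G.finite_index_subgroup_restrict[OF sL G.normal_finite_indexD(1)[OF sL N1(1)] \<Gamma> \<Gamma>L])
  then have "finite_index_subgroup (GL n) \<Gamma> (U0 \<inter> (\<Gamma> \<inter> N1))"
    by (rule G.finite_index_subgroup_Int[OF \<Gamma> U0(1)])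
  then obtain U where U: "normal_finite_index (GL n) \<Gamma> U" "U \<subseteq> U0 \<inter> (\<Gamma> \<inter> N1)"
    by (rule G.normal_core[OF \<Gamma>])
  note Ufi = G.normal_finite_indexD[OF \<Gamma> U(1)]
  have U_unip: "unipotent_subgroup n U"
    using U0(2) U(2) Ufi(2) unfolding unipotent_subgroup_def by blast
  have U_int: "U \<subseteq> GL_Ints n" using U(2) N1(2) by (auto simp: congruence_subgroup_def)
  have UL: "U \<subseteq> \<Lambda>" using Ufi(3) \<Gamma>L by blast
  obtain m :: nat where m: "m > 0" "\<And>x. x \<in> \<Gamma> \<Longrightarrow> x [^]\<^bsub>GL n\<^esub> m \<in> U"
    using G.finite_index_exponent[OF \<Gamma> Ufi(1)] by blast

  \<comment> \<open>A conjugate of \<eta> in \<open>g N\<close> yields a conjugate of its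
    \<open>m\<close>-th power in \<open>g^m N\<close>, and \<open>g^m\<close> lies in
    \<open>U\<close>.\<close>
  have pow: "\<exists>y\<in>N. h \<otimes>\<^bsub>GL n\<^esub> \<eta> [^]\<^bsub>GL n\<^esub> m \<otimes>\<^bsub>GL n\<^esub> inv\<^bsub>GL n\<^esub> h = g [^]\<^bsub>GL n\<^esub> m \<otimes>\<^bsub>GL n\<^esub> y"
    if N: "normal_finite_index (GL n) \<Lambda> N" and h: "h \<in> \<Lambda>" and g: "g \<in> \<Gamma>" and x: "x \<in> N"
      and eq: "h \<otimes>\<^bsub>GL n\<^esub> \<eta> \<otimes>\<^bsub>GL n\<^esub> inv\<^bsub>GL n\<^esub> h = g \<otimes>\<^bsub>GL n\<^esub> x" for N h g x
  proof -
    note fi = G.normal_finite_indexD[OF sL N]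
    have c: "h \<in> carrier (GL n)" "g \<in> carrier (GL n)" "g \<in> \<Lambda>" using h g \<Gamma>L LG by auto
    have "inv\<^bsub>GL n\<^esub> g \<otimes>\<^bsub>GL n\<^esub> y \<otimes>\<^bsub>GL n\<^esub> g \<in> N" if "y \<in> N" for y
      using fi(4)[OF subgroup.m_inv_closed[OF sL c(3)] that] c(2) by simp
    then have "\<exists>y\<in>N. (g \<otimes>\<^bsub>GL n\<^esub> x) [^]\<^bsub>GL n\<^esub> m = g [^]\<^bsub>GL n\<^esub> m \<otimes>\<^bsub>GL n\<^esub> y"
      by (rule G.mult_pow_coset[OF fi(2) c(2) x])
    then show ?thesis unfolding eq[symmetric] G.conj_nat_pow[OF c(1) \<eta>G] .
  qed

  have "\<exists>N. normal_finite_index (GL n) \<Lambda> N \<and>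
    (\<forall>h\<in>\<Lambda>. \<forall>g\<in>\<Gamma>. \<forall>x\<in>N. h \<otimes>\<^bsub>GL n\<^esub> \<eta> \<otimes>\<^bsub>GL n\<^esub> inv\<^bsub>GL n\<^esub> h \<noteq> g \<otimes>\<^bsub>GL n\<^esub> x)"
  proof (cases "\<eta> [^]\<^bsub>GL n\<^esub> m = 1\<^sub>m n")
    case False
    have "semisimple_mat (\<eta> [^]\<^bsub>GL n\<^esub> m)"
      unfolding GL_pow[OF \<eta>G] by (rule semisimple_mat_pow[OF assms(7)])
    then obtain N where N: "normal_finite_index (GL n) \<Lambda> N"
      "\<And>h u x. h \<in> \<Lambda> \<Longrightarrow> u \<in> U \<Longrightarrow> x \<in> N \<Longrightarrow> h * \<eta> [^]\<^bsub>GL n\<^esub> m * inv\<^bsub>GL n\<^esub> h \<noteq> u * x"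
      using separate_semisimple_from_unipotent[OF L U_unip UL U_int
          G.subgroup_nat_pow_closed[OF sL assms(5)] _ False] by blast
    have "h \<otimes>\<^bsub>GL n\<^esub> \<eta> \<otimes>\<^bsub>GL n\<^esub> inv\<^bsub>GL n\<^esub> h \<noteq> g \<otimes>\<^bsub>GL n\<^esub> x"
      if "h \<in> \<Lambda>" "g \<in> \<Gamma>" "x \<in> N" for h g x
      using pow[OF N(1) that] N(2)[OF that(1) m(2)[OF that(2)]] by fastforce
    then show ?thesis using N(1) by blast
  next
    case True
    have "\<eta> \<noteq> 1\<^sub>m n" using assms(6) by simp
    then obtain N where N: "normal_finite_index (GL n) \<Lambda> N"
      "\<And>h u x. h \<in> \<Lambda> \<Longrightarrow> u \<in> U \<Longrightarrow> x \<in> N \<Longrightarrow> h * \<eta> * inv\<^bsub>GL n\<^esub> h \<noteq> u * x"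
      using separate_semisimple_from_unipotent[OF L U_unip UL U_int assms(5,7)] by blast
    have norm: "g * u * inv\<^bsub>GL n\<^esub> g \<in> U" if "g \<in> \<Gamma>" "u \<in> U" for g u
      using Ufi(4)[OF that] by simp
    \<comment> \<open>Level \<open>n\<close> is all of \<open>U\<close>, so the condition on
      \<open>g^m\<close> becomes membership in \<open>U \<inter> N'\<close>.\<close>
    obtain N' where N': "normal_finite_index (GL n) \<Lambda> N'"
      and corr: "\<And>g. g \<in> \<Gamma> \<Longrightarrow> g [^]\<^bsub>GL n\<^esub> m \<in> U \<inter> N' \<Longrightarrow>
        \<exists>u\<in>U. (g \<otimes>\<^bsub>GL n\<^esub> u) [^]\<^bsub>GL n\<^esub> m = 1\<^sub>m n"
      using correct_torsion_unipotent[OF L \<Gamma> \<Gamma>L Ufi(2,3) norm m(1), of n]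
      unfolding unipotent_filtration_top[OF U_unip] by blast
    note NN' = G.normal_finite_index_Int[OF sL N(1) N']
    have False
      if h: "h \<in> \<Lambda>" and g: "g \<in> \<Gamma>" and x: "x \<in> N \<inter> N'"
        and eq: "h \<otimes>\<^bsub>GL n\<^esub> \<eta> \<otimes>\<^bsub>GL n\<^esub> inv\<^bsub>GL n\<^esub> h = g \<otimes>\<^bsub>GL n\<^esub> x" for h g x
    proof -
      have c: "h \<in> carrier (GL n)" "g \<in> carrier (GL n)" using h g \<Gamma>L LG by auto
      obtain y where y: "y \<in> N \<inter> N'"
        "h \<otimes>\<^bsub>GL n\<^esub> \<eta> [^]\<^bsub>GL n\<^esub> m \<otimes>\<^bsub>GL n\<^esub> inv\<^bsub>GL n\<^esub> h = g [^]\<^bsub>GL n\<^esub> m \<otimes>\<^bsub>GL n\<^esub> y"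
        using pow[OF NN' h g x eq] by blast
      have yG: "y \<in> carrier (GL n)" using y(1) G.normal_finite_indexD(3)[OF sL NN'] LG by blast
      \<comment> \<open>The conjugate of the \<open>m\<close>-th power of \<eta> is trivial, so
        \<open>g^m\<close> is the inverse of \<open>y\<close> and thus in \<open>N'\<close>.\<close>
      have "g [^]\<^bsub>GL n\<^esub> m \<otimes>\<^bsub>GL n\<^esub> y = \<one>\<^bsub>GL n\<^esub>"
        using y(2) True GL_inv[OF c(1)] GL_carrier_mat[OF c(1)] by simp
      then have "g [^]\<^bsub>GL n\<^esub> m = inv\<^bsub>GL n\<^esub> y"
        using G.inv_equality[OF _ yG G.nat_pow_closed[OF c(2)]] by simp
      moreover have "inv\<^bsub>GL n\<^esub> y \<in> N'"
        using y(1) subgroup.m_inv_closed[OF G.normal_finite_indexD(2)[OF sL N']] by blast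
      ultimately have "g [^]\<^bsub>GL n\<^esub> m \<in> U \<inter> N'" using m(2)[OF g] by simp
      then obtain u where u: "u \<in> U" "(g \<otimes>\<^bsub>GL n\<^esub> u) [^]\<^bsub>GL n\<^esub> m = \<one>\<^bsub>GL n\<^esub>"
        using corr[OF g] by auto
      \<comment> \<open>The product \<open>g u\<close> has finite order in the torsion free
        \<Gamma>, hence is trivial. So \<open>g\<close> lies in \<open>U\<close>, from which
        \<open>N\<close> separates \<eta>.\<close>
      have "g \<otimes>\<^bsub>GL n\<^esub> u \<in> \<Gamma>" using g u(1) Ufi(3) by (intro subgroup.m_closed[OF \<Gamma>]) auto
      then have gu: "g \<otimes>\<^bsub>GL n\<^esub> u = \<one>\<^bsub>GL n\<^esub>"
        using assms(3) m(1) u(2) unfolding torsion_free_def by blast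
      have uG: "u \<in> carrier (GL n)" using u(1) UL LG by blast
      have "g = inv\<^bsub>GL n\<^esub> u" using G.inv_equality[OF gu uG c(2)] by simp
      then have "g \<in> U" using subgroup.m_inv_closed[OF Ufi(2) u(1)] by simp
      then show False using N(2)[OF h] x eq by auto
    qed
    then show ?thesis using NN' by blast
  qed
  then obtain N where N: "normal_finite_index (GL n) \<Lambda> N"
    "\<And>h g x. h \<in> \<Lambda> \<Longrightarrow> g \<in> \<Gamma> \<Longrightarrow> x \<in> N \<Longrightarrow>
      h \<otimes>\<^bsub>GL n\<^esub> \<eta> \<otimes>\<^bsub>GL n\<^esub> inv\<^bsub>GL n\<^esub> h \<noteq> g \<otimes>\<^bsub>GL n\<^esub> x"
    by blast
  let ?L0 = "\<Gamma> <#>\<^bsub>GL n\<^esub> N"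
  note L0 = G.finite_index_mult_normal[OF sL \<Gamma> \<Gamma>L N(1)]
  have "subgroup \<Gamma> (GL n\<lparr>carrier := ?L0\<rparr>)"
    by (rule G.subgroup_incl[OF \<Gamma> G.finite_index_subgroupD(1)[OF sL L0(1)] L0(2)])
  moreover have "conjugacy_class (GL n) \<Lambda> \<eta> \<inter> ?L0 = {}"
    using N(2) unfolding conjugacy_class_def set_mult_def by blast
  ultimately show ?thesis using L0(1) by blast
qed

end
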